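(* Assume that the family $(f_i)_{i=1}^N$ of contractive similitudes on $\mathbb{R}^q$, with contraction ratios $(s_i)_{i=1}^N$, satisfies the open set condition. Let $\nu$ be the self-similar measure associated with $(f_i)_{i=1}^N$ and a probability vector $(t_i)_{i=1}^N$ with $t_i>0$ for all $1\leq i\leq N$. Let $(p_i)_{i=0}^N$ be a probability vector with $p_i>0$ for all $0\leq i\leq N$, and let $\mu$ be the unique Borel probability measure satisfying $\mu=p_0\nu+\sum_{i=1}^Np_i\,\mu\circ f_i^{-1}$. For every $r>0$ let $\xi_{1,r},\xi_{2,r}>0$ be given by $$\sum_{i=1}^N(t_is_i^r)^{\frac{\xi_{1,r}}{\xi_{1,r}+r}}=1,\qquad \sum_{i=1}^N(p_is_i^r)^{\frac{\xi_{2,r}}{\xi_{2,r}+r}}=1,$$ and set $\xi_r:=\max\{\xi_{1,r},\xi_{2,r}\}$. Then for every $r>0$, the quantization dimension $D_r(\mu)$ exists and equals $\xi_r$, and $\underline{Q}_r^{\xi_r}(\mu)>0$. Moreover, for every $r>0$: (a) if $\xi_{1,r}>\xi_{2,r}$, then $\overline{Q}_r^{\xi_r}(\mu)<\infty$; (b) if $\xi_{1,r}=\xi_{2,r}$, then $\underline{Q}_r^{\xi_r}(\mu)=\infty$.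
   Context: Throughout $N\geq 2$. A contractive similitude $f_i:\mathbb{R}^q\to\mathbb{R}^q$ with contraction ratio $s_i\in(0,1)$ satisfies $|f_i(x)-f_i(y)|=s_i|x-y|$ for all $x,y$. Open set condition (OSC): there is a non-empty open set $U\subset\mathbb{R}^q$ with $f_i(U)\subset U$ for all $i$ and $f_i(U)\cap f_j(U)=\emptyset$ for all $i\neq j$. The self-similar measure associated with $(f_i)_{i=1}^N$ and $(t_i)_{i=1}^N$ is the unique Borel probability measure $\nu$ on $\mathbb{R}^q$ with $\nu=\sum_{i=1}^Nt_i\,\nu\circ f_i^{-1}$. For a Borel probability measure $P$ on $\mathbb{R}^q$, $r>0$ and $n\in\mathbb{N}$, the $n$th quantization error of order $r$ is $$e_{n,r}(P):=\inf_{\alpha\subset\mathbb{R}^q,\;1\leq{\rm card}(\alpha)\leq n}\Big(\int d(x,\alpha)^r\,dP(x)\Big)^{1/r},$$ where $d(x,\alpha)$ is the Euclidean distance from $x$ to $\alpha$. The upper and lower quantization dimensions of order $r$ are $$\overline{D}_r(P):=\limsup_{n\to\infty}\frac{\log n}{-\log e_{n,r}(P)},\qquad \underline{D}_r(P):=\liminf_{n\to\infty}\frac{\log n}{-\log e_{n,r}(P)};$$ if they coincide, the common value is called the quantization dimension $D_r(P)$ and $D_r(P)$ is said to exist. For $s>0$ the $s$-dimensional upper and lower quantization coefficients are $$\overline{Q}_r^s(P):=\limsup_{n\to\infty}n^{1/s}e_{n,r}(P),\qquad \underline{Q}_r^s(P):=\liminf_{n\to\infty}n^{1/s}e_{n,r}(P).$$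 *)

theory Defs
  imports "HOL-Analysis.Analysis" "HOL-Probability.Probability"
begin

definition contractive_similitude :: "('a::metric_space \<Rightarrow> 'a) \<Rightarrow> real \<Rightarrow> bool" where
  "contractive_similitude f s \<longleftrightarrow>
     0 < s \<and> s < 1 \<and> (\<forall>x y. dist (f x) (f y) = s * dist x y)"

definition open_set_condition :: "nat \<Rightarrow> (nat \<Rightarrow> 'a::topological_space \<Rightarrow> 'a) \<Rightarrow> bool" where
  "open_set_condition N f \<longleftrightarrow>
     (\<exists>U. open U \<and> U \<noteq> {} \<and> (\<forall>i\<in>{1..N}. f i ` U \<subseteq> U) \<and>
          (\<forall>i\<in>{1..N}. \<forall>j\<in>{1..N}. i \<noteq> j \<longrightarrow> f i ` U \<inter> f j ` U = {}))"

definition positive_probability_vector :: "nat set \<Rightarrow> (nat \<Rightarrow> real) \<Rightarrow> bool" where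
  "positive_probability_vector I p \<longleftrightarrow> (\<forall>i\<in>I. p i > 0) \<and> (\<Sum>i\<in>I. p i) = 1"

definition borel_probability_measure :: "'a::topological_space measure \<Rightarrow> bool" where
  "borel_probability_measure P \<longleftrightarrow> prob_space P \<and> sets P = sets borel"

text \<open>For contractive similitudes of a Euclidean space and a probability vector, the following
  equation has exactly one solution among the Borel probability measures, so the predicate
  determines \<open>\<nu>\<close>; likewise for \<open>\<mu>\<close> in the inhomogeneous equation, when the weight at index 0
  is positive.\<close>

definition self_similar_measure ::
  "nat \<Rightarrow> (nat \<Rightarrow> 'a::topological_space \<Rightarrow> 'a) \<Rightarrow> (nat \<Rightarrow> real) \<Rightarrow> 'a measure \<Rightarrow> bool" where
  "self_similar_measure N f t \<nu> \<longleftrightarrow>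
     borel_probability_measure \<nu> \<and>
     (\<forall>A\<in>sets borel. emeasure \<nu> A = (\<Sum>i=1..N. ennreal (t i) * emeasure \<nu> (f i -` A)))"

definition inhomogeneous_self_similar_measure ::
  "nat \<Rightarrow> (nat \<Rightarrow> 'a::topological_space \<Rightarrow> 'a) \<Rightarrow> (nat \<Rightarrow> real) \<Rightarrow> 'a measure \<Rightarrow> 'a measure \<Rightarrow> bool" where
  "inhomogeneous_self_similar_measure N f p \<nu> \<mu> \<longleftrightarrow>
     borel_probability_measure \<mu> \<and>
     (\<forall>A\<in>sets borel. emeasure \<mu> A =
        ennreal (p 0) * emeasure \<nu> A + (\<Sum>i=1..N. ennreal (p i) * emeasure \<mu> (f i -` A)))"

text \<open>Real powers with positive exponent, and the logarithm, extended to \<open>[0, \<infinity>]\<close>: the integral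
  defining the quantization error is infinite for measures without finite \<open>r\<close>-th moment, and the
  error vanishes for measures with finite support.\<close>

definition ennreal_powr :: "ennreal \<Rightarrow> real \<Rightarrow> ennreal" where
  "ennreal_powr x a = (if x = \<infinity> then \<infinity> else ennreal (enn2real x powr a))"

definition ennreal_ln :: "ennreal \<Rightarrow> ereal" where
  "ennreal_ln x = (if x = 0 then -\<infinity> else if x = \<infinity> then \<infinity> else ereal (ln (enn2real x)))"

text \<open>Infinite sets have \<open>card \<alpha> = 0\<close>, so the lower bound on the cardinality restricts
  the infimum to finite non-empty sets.\<close>

definition quantization_error :: "nat \<Rightarrow> real \<Rightarrow> 'a::metric_space measure \<Rightarrow> ennreal" where
  "quantization_error n r P =
     (INF \<alpha>\<in>{\<alpha>. 1 \<le> card \<alpha> \<and> card \<alpha> \<le> n}.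
        ennreal_powr (\<integral>\<^sup>+ x. ennreal (infdist x \<alpha> powr r) \<partial>P) (1 / r))"

definition upper_quantization_dimension :: "real \<Rightarrow> 'a::metric_space measure \<Rightarrow> ereal" where
  "upper_quantization_dimension r P =
     limsup (\<lambda>n. ereal (ln (real n)) / (- ennreal_ln (quantization_error n r P)))"

definition lower_quantization_dimension :: "real \<Rightarrow> 'a::metric_space measure \<Rightarrow> ereal" where
  "lower_quantization_dimension r P =
     liminf (\<lambda>n. ereal (ln (real n)) / (- ennreal_ln (quantization_error n r P)))"

definition has_quantization_dimension :: "real \<Rightarrow> 'a::metric_space measure \<Rightarrow> ereal \<Rightarrow> bool" where
  "has_quantization_dimension r P D \<longleftrightarrow>
     lower_quantization_dimension r P = D \<and> upper_quantization_dimension r P = D"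

definition upper_quantization_coefficient ::
  "real \<Rightarrow> real \<Rightarrow> 'a::metric_space measure \<Rightarrow> ennreal" where
  "upper_quantization_coefficient s r P =
     limsup (\<lambda>n. ennreal (real n powr (1 / s)) * quantization_error n r P)"

definition lower_quantization_coefficient ::
  "real \<Rightarrow> real \<Rightarrow> 'a::metric_space measure \<Rightarrow> ennreal" where
  "lower_quantization_coefficient s r P =
     liminf (\<lambda>n. ennreal (real n powr (1 / s)) * quantization_error n r P)"

end

theory Submission
  imports Defs "HOL-Library.Sublist" "HOL-Real_Asymp.Real_Asymp"
begin

text \<open>Put \<open>a i = (t i * s i powr r) powr (1 / (1 + r / u))\<close> and
  \<open>b i = (p i * s i powr r) powr (1 / (1 + r / u))\<close>. A copy of a measure under \<open>f i\<close> with weight \<open>t i\<close>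
  turns a quantizer with \<open>x * a i\<close> points and error \<open>(x * a i) powr (-(r / u))\<close> into one with error
  \<open>a i * x powr (-(r / u))\<close>. Hence if the \<open>a i\<close> sum to 1, a bound of this shape reproduces itself; with a
  real parameter \<open>x\<close> in place of the number of points there is no rounding loss. In the equation for
  \<open>\<mu>\<close> the sum of the \<open>b i\<close> has to be less than 1, which leaves room for the points spent on \<open>\<nu>\<close>.

  For the lower bounds the same recursion produces antichains of \<open>2 * n\<close> words of comparable weight.
  By the separation property of Schief, derived from the open set condition, each of \<open>n\<close> given points is
  close to the core of at most one of the corresponding pieces, so that \<open>n\<close> pieces are badly
  approximated. Iterating the equation, \<open>\<mu>\<close> dominates \<open>p 0\<close> times the sum over all \<open>k\<close> of the images of
  \<open>\<nu>\<close> under the words of length \<open>k\<close>. If both exponents agree, each of these levels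
  contributes an error of the full order, and the number of levels is unbounded.\<close>

section \<open>Words and separation\<close>

text \<open>The exponent \<open>\<xi> / (\<xi> + r)\<close> equals
  \<open>1 / (1 + r / \<xi>)\<close>. It arises since a piece of weight \<open>q\<close> and ratio
  \<open>c\<close> that receives the share \<open>b\<close> of \<open>x\<close> points has an error
  of order \<open>q * c powr r * (x * b) powr (-(r / u))\<close>, and this is
  \<open>b * x powr (-(r / u))\<close> exactly when
  \<open>b powr (1 + r / u) = q * c powr r\<close>. The open set condition alone does not serve the
  lower bounds: the images of \<open>U\<close> are disjoint, but they may touch, and nothing in the
  condition gives \<open>U\<close> positive mass. Hence the detour through a core, the image of a
  large ball under a suitable \<open>wmap \<sigma>\<close>: it has positive mass, and its images
  under incomparable words are apart in proportion to their ratios. As a share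
  \<open>x * b i\<close> may fall below 1, the inductions run over \<open>x \<ge> m\<close> with
  \<open>m\<close> a lower bound of the shares; the range up to 1 is absorbed into the constants.
  The dimension only asks for upper rates at every \<open>u > \<xi>\<close>, where both sums are
  below 1. The borderline \<open>u = \<xi>\<close> is reached in case (a), where the sum for
  \<open>p\<close> is still below 1.\<close>

lemma compact_separated_card_bound:
  fixes K :: "'a::metric_space set"
  assumes "compact K" "\<eta> > 0"
  obtains M where "\<And>S. S \<subseteq> K \<Longrightarrow> (\<And>x y. x \<in> S \<Longrightarrow> y \<in> S \<Longrightarrow> x \<noteq> y \<Longrightarrow> \<eta> \<le> dist x y)
    \<Longrightarrow> finite S \<and> card S \<le> M"
proof -
  obtain T where T: "finite T" "K \<subseteq> (\<Union>x\<in>T. ball x (\<eta>/2))"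
    using seq_compact_imp_totally_bounded[of K] assms by (metis compact_eq_seq_compact_metric half_gt_zero)
  show ?thesis
  proof (rule that)
    fix S assume S: "S \<subseteq> K" "\<And>x y. x \<in> S \<Longrightarrow> y \<in> S \<Longrightarrow> x \<noteq> y \<Longrightarrow> \<eta> \<le> dist x y"
    have "\<forall>x\<in>S. \<exists>c\<in>T. dist c x < \<eta>/2"
      using S(1) T(2) by (auto simp: subset_eq)
    then obtain c where c: "\<And>x. x \<in> S \<Longrightarrow> c x \<in> T" "\<And>x. x \<in> S \<Longrightarrow> dist (c x) x < \<eta>/2"
      by metis
    \<comment> \<open>Two points of \<open>S\<close> with the same centre would be closer than
      \<open>\<eta>\<close>. So \<open>card T\<close> bounds all separated sets at once, and this
      uniformity is what the count of neighbours needs.\<close>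
    have "inj_on c S"
    proof (rule inj_onI, rule ccontr)
      fix x y assume h: "x \<in> S" "y \<in> S" "c x = c y" "x \<noteq> y"
      have "dist x y < \<eta>"
        using c(2)[OF h(1)] c(2)[OF h(2)] h(3) dist_triangle_half_r[of "c x" x \<eta> y] by metis
      with S(2)[of x y] h show False by simp
    qed
    moreover have "c ` S \<subseteq> T" using c(1) by auto
    ultimately show "finite S \<and> card S \<le> card T"
      using T(1) by (metis card_inj_on_le inj_on_finite)
  qed
qed

text \<open>Translated and rescaled, the map is an isometry fixing 0, hence linear and orthogonal,
  hence onto. Surjectivity is what makes images of balls contain balls.\<close>

lemma similitude_surj:
  fixes g :: "'a::euclidean_space \<Rightarrow> 'a"
  assumes "contractive_similitude g c"
  shows "surj g"
proof -
  have c: "c > 0" and d: "\<And>x y. dist (g x) (g y) = c * dist x y"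
    using assms by (auto simp: contractive_similitude_def)
  define h where "h x = (1/c) *\<^sub>R (g x - g 0)" for x
  have "dist (h x) (h y) = dist x y" for x y
  proof -
    have "h x - h y = (1/c) *\<^sub>R (g x - g y)"
      by (simp add: h_def algebra_simps)
    then have "norm (h x - h y) = (1/c) * norm (g x - g y)" using c by simp
    then show ?thesis using d[of x y] c by (simp add: dist_norm)
  qed
  then have "orthogonal_transformation h"
    by (simp add: orthogonal_transformation_isometry h_def)
  then have s: "surj h" by (rule orthogonal_transformation_surj)
  show ?thesis
  proof (rule surjI)
    fix y
    show "g (inv h ((1/c) *\<^sub>R (y - g 0))) = y"
      using surj_f_inv_f[OF s, of "(1/c) *\<^sub>R (y - g 0)"] c by (simp add: h_def)
  qed
qed

section \<open>Words over the alphabet of maps, their compositions and ratios\<close>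

locale similitude_system =
  fixes N :: nat and f :: "nat \<Rightarrow> 'a::euclidean_space \<Rightarrow> 'a" and s :: "nat \<Rightarrow> real"
  assumes similitude: "\<And>i. i \<in> {1..N} \<Longrightarrow> contractive_similitude (f i) (s i)"
begin

definition words :: "nat list set" where "words = lists {1..N}"

lemma words_simps [simp]: "[] \<in> words" "i # w \<in> words \<longleftrightarrow> i \<in> {1..N} \<and> w \<in> words"
  "u @ v \<in> words \<longleftrightarrow> u \<in> words \<and> v \<in> words"
  by (auto simp: words_def)

primrec wmap :: "nat list \<Rightarrow> 'a \<Rightarrow> 'a" where
  "wmap [] = id"
| "wmap (i # w) = f i \<circ> wmap w"

definition ratio :: "nat list \<Rightarrow> real" where "ratio w = prod_list (map s w)"

lemma s_pos: "i \<in> {1..N} \<Longrightarrow> s i > 0" and s_less_1: "i \<in> {1..N} \<Longrightarrow> s i < 1"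
  and dist_f: "i \<in> {1..N} \<Longrightarrow> dist (f i x) (f i y) = s i * dist x y"
  using similitude by (auto simp: contractive_similitude_def)

lemma wmap_append: "wmap (u @ v) = wmap u \<circ> wmap v"
  by (induction u) auto

lemma ratio_simps [simp]: "ratio [] = 1" "ratio (i # w) = s i * ratio w"
  "ratio (u @ v) = ratio u * ratio v"
  by (auto simp: ratio_def)

lemma ratio_pos: "w \<in> words \<Longrightarrow> ratio w > 0"
  by (induction w) (auto simp: s_pos)

lemma ratio_le_1: "w \<in> words \<Longrightarrow> ratio w \<le> 1"
proof (induction w)
  case (Cons i w)
  then have "i \<in> {1..N}" "w \<in> words" by auto
  then show ?case
    using Cons.IH ratio_pos[of w] s_less_1[of i] s_pos[of i] by (auto intro!: mult_le_one)
qed simp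

lemma ratio_less_1: "w \<in> words \<Longrightarrow> w \<noteq> [] \<Longrightarrow> ratio w < 1"
proof (cases w)
  case (Cons i v)
  assume "w \<in> words"
  with Cons have "i \<in> {1..N}" "v \<in> words" by auto
  then have "s i * ratio v \<le> s i * 1"
    using ratio_le_1 s_pos by (intro mult_left_mono) (auto simp: less_imp_le)
  with Cons s_less_1[OF \<open>i \<in> {1..N}\<close>] show ?thesis by simp
qed simp

lemma dist_wmap: "w \<in> words \<Longrightarrow> dist (wmap w x) (wmap w y) = ratio w * dist x y"
  by (induction w) (auto simp: dist_f)

lemma continuous_f: "i \<in> {1..N} \<Longrightarrow> continuous_on UNIV (f i)"
  using dist_f[of i] s_pos[of i]
  by (intro lipschitz_on_continuous_on[of "s i"] lipschitz_onI) auto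

lemma continuous_wmap: "w \<in> words \<Longrightarrow> continuous_on UNIV (wmap w)"
  using dist_wmap[of w] ratio_pos[of w]
  by (intro lipschitz_on_continuous_on[of "ratio w"] lipschitz_onI) auto

lemma measurable_f: "i \<in> {1..N} \<Longrightarrow> f i \<in> borel_measurable borel"
  by (intro borel_measurable_continuous_onI continuous_f)

lemma surj_wmap: "w \<in> words \<Longrightarrow> surj (wmap w)"
proof (induction w)
  case (Cons i w)
  then have "surj (f i)" "surj (wmap w)" using similitude_surj[OF similitude[of i]] by auto
  then show ?case by (simp only: wmap.simps comp_surj)
qed simp

lemma inj_wmap: "w \<in> words \<Longrightarrow> inj (wmap w)"
  using dist_wmap[of w] ratio_pos[of w] by (intro injI) (metis dist_eq_0_iff mult_eq_0_iff less_irrefl)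

lemma wmap_ball:
  assumes "w \<in> words"
  shows "wmap w ` ball x \<rho> = ball (wmap w x) (ratio w * \<rho>)"
proof
  show "wmap w ` ball x \<rho> \<subseteq> ball (wmap w x) (ratio w * \<rho>)"
    using assms by (auto simp: dist_wmap ratio_pos)
  show "ball (wmap w x) (ratio w * \<rho>) \<subseteq> wmap w ` ball x \<rho>"
  proof
    fix y assume y: "y \<in> ball (wmap w x) (ratio w * \<rho>)"
    obtain z where z: "y = wmap w z" using surj_wmap[OF assms] by (metis surjD)
    with y have "ratio w * dist x z < ratio w * \<rho>" by (simp add: dist_wmap assms)
    then have "z \<in> ball x \<rho>" using ratio_pos[OF assms] by simp
    with z show "y \<in> wmap w ` ball x \<rho>" by blast
  qed
qed

lemma wmap_invariant:
  assumes "\<And>i. i \<in> {1..N} \<Longrightarrow> f i ` B \<subseteq> B" "w \<in> words" "x \<in> B"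
  shows "wmap w x \<in> B"
  using assms(2,3)
proof (induction w)
  case (Cons i w)
  then have "i \<in> {1..N}" "wmap w x \<in> B" by auto
  then show ?case using assms(1)[of i] by auto
qed simp

text \<open>Injectivity strips the common prefix; the remaining words start with different letters,
  to which the open set condition applies.\<close>

lemma parallel_wmap_disjoint:
  assumes U: "\<And>i. i \<in> {1..N} \<Longrightarrow> f i ` U \<subseteq> U"
    "\<And>i j. i \<in> {1..N} \<Longrightarrow> j \<in> {1..N} \<Longrightarrow> i \<noteq> j \<Longrightarrow> f i ` U \<inter> f j ` U = {}"
  and w: "u \<in> words" "v \<in> words" "u \<parallel> v"
  shows "wmap u ` U \<inter> wmap v ` U = {}"
proof (rule ccontr)
  assume "\<not> ?thesis"
  then obtain x y where xy: "x \<in> U" "y \<in> U" "wmap u x = wmap v y" by blast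
  obtain as b bs c cs where d: "b \<noteq> c" "u = as @ b # bs" "v = as @ c # cs"
    using parallel_decomp[OF w(3)] by blast
  have "as \<in> words" "b \<in> {1..N}" "c \<in> {1..N}" "bs \<in> words" "cs \<in> words"
    using w d by auto
  moreover have "f b (wmap bs x) = f c (wmap cs y)"
    using xy(3) d inj_wmap[OF \<open>as \<in> words\<close>] by (simp add: wmap_append inj_eq)
  moreover have "wmap bs x \<in> U" "wmap cs y \<in> U"
    using wmap_invariant[OF U(1)] xy calculation by blast+
  ultimately show False using U(2)[of b c] d(1) by blast
qed

lemma invariant_cball:
  obtains R0 where "R0 > 0" "\<And>R i. R0 \<le> R \<Longrightarrow> i \<in> {1..N} \<Longrightarrow> norm (f i 0) + s i * R \<le> R"
proof -
  \<comment> \<open>Each summand is the smallest radius that works for its letter; the sum dominates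
    them all, and the 1 gives positivity.\<close>
  define R0 where "R0 = 1 + (\<Sum>i\<in>{1..N}. norm (f i 0) / (1 - s i))"
  have nn: "0 \<le> norm (f i 0) / (1 - s i)" if "i \<in> {1..N}" for i using s_less_1[OF that] by simp
  show ?thesis
  proof (rule that)
    show "R0 > 0" unfolding R0_def using sum_nonneg[of "{1..N}" "\<lambda>i. norm (f i 0) / (1 - s i)"] nn by simp
    fix R i assume h: "R0 \<le> R" "i \<in> {1..N}"
    have "norm (f i 0) / (1 - s i) \<le> (\<Sum>i\<in>{1..N}. norm (f i 0) / (1 - s i))"
      using nn h(2) by (intro member_le_sum) auto
    with h have "norm (f i 0) / (1 - s i) \<le> R" unfolding R0_def by linarith
    with s_less_1[OF h(2)] show "norm (f i 0) + s i * R \<le> R"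
      by (simp add: divide_simps algebra_simps)
  qed
qed

lemma cball_invariantI:
  assumes "norm (f i 0) + s i * R \<le> R" "i \<in> {1..N}"
  shows "f i ` cball 0 R \<subseteq> cball 0 R"
proof
  fix y assume "y \<in> f i ` cball 0 R"
  then obtain x where x: "y = f i x" "norm x \<le> R" by auto
  have "norm (f i x) \<le> norm (f i 0) + dist (f i x) (f i 0)"
    by (metis dist_norm norm_triangle_sub)
  also have "\<dots> \<le> norm (f i 0) + s i * R"
    using dist_f[OF assms(2), of x 0] x(2) s_pos[OF assms(2)] by simp
  finally show "y \<in> cball 0 R" using assms(1) x(1) by simp
qed

section \<open>Neighbouring pieces and the separation property\<close>

text \<open>The two ratio conditions make \<open>v\<close> a stopping word: the ratio drops to
  \<open>ratio w\<close> or below for the first time at its last letter. Closeness is measured at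
  the scale of \<open>w\<close> itself, which makes the notion invariant under prefixing.\<close>

definition neighbours :: "real \<Rightarrow> nat list \<Rightarrow> nat list set" where
  "neighbours R w = {v\<in>words. v \<noteq> [] \<and> ratio v \<le> ratio w \<and> ratio w < ratio (butlast v) \<and>
     (\<exists>x\<in>cball 0 R. \<exists>y\<in>cball 0 R. dist (wmap v x) (wmap w y) < ratio w)}"

text \<open>A proper prefix of \<open>v\<close> is a prefix of \<open>butlast v\<close>, and ratios
  do not grow along a word. So a stopping word inside another would put the ratio of
  \<open>butlast v\<close> at \<open>c\<close> or below.\<close>

lemma stopping_words_parallel:
  assumes "u \<in> words" "v \<in> words" "u \<noteq> []" "v \<noteq> []" "u \<noteq> v"
    "ratio u \<le> c" "ratio v \<le> c" "c < ratio (butlast u)" "c < ratio (butlast v)"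
  shows "u \<parallel> v"
proof -
  have *: False if h: "u \<in> words" "v \<in> words" "u \<noteq> v" "ratio u \<le> c" "c < ratio (butlast v)"
    "prefix u v" for u v
  proof -
    from h(3,6) have "strict_prefix u v" by simp
    then have "v \<noteq> []" by auto
    then have "prefix u (butlast v)" using h(3,6)
      by (metis append_butlast_last_id prefix_snoc)
    then obtain z where z: "butlast v = u @ z" by (auto simp: prefix_def)
    then have "z \<in> words" using h(2) by (auto simp: words_def dest: in_set_butlastD) (metis Un_iff in_set_butlastD set_append)+
    then have "ratio (butlast v) \<le> ratio u"
      using z ratio_le_1[of z] ratio_pos[OF h(1)] by (simp add: mult_left_le)
    with h show False by simp
  qed
  show ?thesis using *[of u v] *[of v u] assms by (intro parallelI) auto
qed

text \<open>Rescaled to the size of \<open>w\<close>, the images of one interior point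
  \<open>x0\<close> of \<open>U\<close> under the neighbours lie in a fixed ball and are uniformly
  apart; compactness bounds their number independently of \<open>w\<close>.\<close>

lemma neighbours_card_bound:
  assumes N: "N \<ge> 1" and osc: "open_set_condition N f"
    and inv: "\<And>R i. R0 \<le> R \<Longrightarrow> i \<in> {1..N} \<Longrightarrow> f i ` cball 0 R \<subseteq> cball 0 R"
  obtains R M where "R \<ge> R0" "R > 0"
    "\<And>w. w \<in> words \<Longrightarrow> finite (neighbours R w) \<and> card (neighbours R w) \<le> M"
proof -
  obtain U where U: "open U" "U \<noteq> {}" "\<And>i. i \<in> {1..N} \<Longrightarrow> f i ` U \<subseteq> U"
    "\<And>i j. i \<in> {1..N} \<Longrightarrow> j \<in> {1..N} \<Longrightarrow> i \<noteq> j \<Longrightarrow> f i ` U \<inter> f j ` U = {}"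
    using osc unfolding open_set_condition_def by metis
  obtain x0 \<rho> where x0: "\<rho> > 0" "ball x0 \<rho> \<subseteq> U" using U(1,2) by (meson openE ex_in_conv)
  define R where "R = max 1 (max R0 (norm x0))"
  have R: "R \<ge> R0" "R > 0" "norm x0 \<le> R" by (auto simp: R_def)
  \<comment> \<open>The last letter of a stopping word multiplies the ratio by at least
    \<open>m\<close>, so this ratio lies between \<open>m * ratio w\<close> and
    \<open>ratio w\<close>.\<close>
  define m where "m = Min (s ` {1..N})"
  have m: "m > 0" "\<And>i. i \<in> {1..N} \<Longrightarrow> m \<le> s i"
    using N s_pos by (auto simp: m_def Min_gr_iff)
  obtain M where M: "\<And>S. S \<subseteq> cball (0::'a) (3 * R + 1) \<Longrightarrow>
    (\<And>x y. x \<in> S \<Longrightarrow> y \<in> S \<Longrightarrow> x \<noteq> y \<Longrightarrow> m * \<rho> \<le> dist x y) \<Longrightarrow> finite S \<and> card S \<le> M"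
    using compact_separated_card_bound[of "cball (0::'a) (3 * R + 1)" "m * \<rho>"]
      compact_cball mult_pos_pos[OF m(1) x0(1)] by metis
  have "finite (neighbours R w) \<and> card (neighbours R w) \<le> M" if w: "w \<in> words" for w
  proof -
    define z where "z v = (1 / ratio w) *\<^sub>R (wmap v x0 - wmap w 0)" for v
    have rw: "ratio w > 0" using w by (rule ratio_pos)
    have sep: "m * \<rho> \<le> dist (z u) (z v)"
      if uv: "u \<in> neighbours R w" "v \<in> neighbours R w" "u \<noteq> v" for u v
    proof -
      have n: "u \<in> words" "v \<in> words" "u \<noteq> []" "v \<noteq> []" "ratio w < ratio (butlast u)"
        "ratio u \<le> ratio w" "ratio v \<le> ratio w" "ratio w < ratio (butlast v)"
        using uv by (auto simp: neighbours_def)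
      have "u \<parallel> v" using stopping_words_parallel[of u v "ratio w"] n uv(3) by blast
      then have "wmap u ` U \<inter> wmap v ` U = {}"
        using parallel_wmap_disjoint[OF U(3,4)] n by blast
      then have "wmap u ` ball x0 \<rho> \<inter> wmap v ` ball x0 \<rho> = {}" using x0(2) by blast
      moreover have "wmap v x0 \<in> wmap v ` ball x0 \<rho>" using x0(1) by auto
      ultimately have "wmap v x0 \<notin> ball (wmap u x0) (ratio u * \<rho>)"
        using wmap_ball[OF n(1)] by blast
      then have d: "ratio u * \<rho> \<le> dist (wmap u x0) (wmap v x0)" by simp
      have "last u \<in> {1..N}" using n(1,3) unfolding words_def by (metis in_listsD last_in_set)
      have "ratio u = ratio (butlast u) * s (last u)"
        using n(3) by (metis append_butlast_last_id ratio_simps(1,2,3) mult.right_neutral)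
      moreover have "ratio w * m \<le> ratio (butlast u) * s (last u)"
        using n m(2)[OF \<open>last u \<in> {1..N}\<close>] m(1) rw by (intro mult_mono) auto
      ultimately have "ratio w * m * \<rho> \<le> ratio u * \<rho>" using x0(1) by simp
      with d have "ratio w * (m * \<rho>) \<le> norm (wmap u x0 - wmap v x0)" by (simp add: dist_norm mult.assoc)
      moreover have "z u - z v = (1 / ratio w) *\<^sub>R (wmap u x0 - wmap v x0)"
        by (simp add: z_def algebra_simps)
      then have "dist (z u) (z v) = norm (wmap u x0 - wmap v x0) / ratio w"
        using rw by (simp add: dist_norm)
      ultimately show ?thesis using rw by (simp add: pos_le_divide_eq mult.commute)
    qed
    have bd: "z v \<in> cball 0 (3 * R + 1)" if v: "v \<in> neighbours R w" for v
    proof -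
      obtain x y where xy: "norm x \<le> R" "norm y \<le> R" "dist (wmap v x) (wmap w y) < ratio w"
        and n: "v \<in> words" "ratio v \<le> ratio w"
        using v by (auto simp: neighbours_def)
      have "dist (wmap v x0) (wmap w 0) \<le> dist (wmap v x0) (wmap v x) + dist (wmap v x) (wmap w y)
          + dist (wmap w y) (wmap w 0)"
        by (meson add_mono_thms_linordered_semiring(3) dist_triangle order_trans)
      also have "\<dots> \<le> ratio w * (2 * R) + ratio w + ratio w * R"
      proof -
        have "dist x0 x \<le> 2 * R" using R(3) xy(1) by (smt (verit) norm_triangle_ineq4 dist_norm)
        then have "ratio v * dist x0 x \<le> ratio w * (2 * R)"
          using n rw ratio_pos[OF n(1)] by (intro mult_mono) auto
        moreover have "ratio w * dist y 0 \<le> ratio w * R" using xy rw by simp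
        ultimately show ?thesis using xy(3) by (simp add: dist_wmap n(1) w algebra_simps)
      qed
      also have "\<dots> = ratio w * (3 * R + 1)" by (simp add: algebra_simps)
      finally have "norm (wmap v x0 - wmap w 0) / ratio w \<le> 3 * R + 1"
        using rw by (simp add: dist_norm pos_divide_le_eq mult.commute)
      moreover have "norm (z v) = norm (wmap v x0 - wmap w 0) / ratio w"
        using rw by (simp add: z_def)
      ultimately show ?thesis by simp
    qed
    have inj: "inj_on z (neighbours R w)"
      using sep m(1) x0(1) by (intro inj_onI) (smt (verit) dist_eq_0_iff mult_pos_pos)
    have "finite (z ` neighbours R w) \<and> card (z ` neighbours R w) \<le> M"
      by (rule M) (use bd sep in auto)
    with inj show ?thesis by (simp add: card_image finite_image_iff)
  qed
  with R that show ?thesis by blast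
qed

text \<open>The idea (Schief) is to choose a word \<open>\<sigma>\<close> with the maximal number of neighbours: prefixing
  \<open>\<sigma>\<close> by \<open>u\<close> then creates no neighbours besides the prefixed neighbours of \<open>\<sigma>\<close>.\<close>

lemma strong_separation:
  assumes N: "N \<ge> 1" and osc: "open_set_condition N f"
    and inv: "\<And>R i. R0 \<le> R \<Longrightarrow> i \<in> {1..N} \<Longrightarrow> f i ` cball 0 R \<subseteq> cball 0 R"
  obtains R \<sigma> \<delta> where "R \<ge> R0" "R > 0" "\<sigma> \<in> words" "\<delta> > 0"
    "\<And>u v x y. u \<in> words \<Longrightarrow> v \<in> words \<Longrightarrow> u \<parallel> v \<Longrightarrow> x \<in> wmap \<sigma> ` cball 0 R \<Longrightarrow>
      y \<in> wmap \<sigma> ` cball 0 R \<Longrightarrow> \<delta> * (ratio u + ratio v) \<le> dist (wmap u x) (wmap v y)"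
proof -
  obtain R M where R: "R \<ge> R0" "R > 0"
    and M: "\<And>w. w \<in> words \<Longrightarrow> finite (neighbours R w) \<and> card (neighbours R w) \<le> M"
    using neighbours_card_bound[OF N osc inv] by blast
  have "[1] \<in> words \<and> [1] \<noteq> []" using N by auto
  then obtain \<sigma> where \<sigma>: "\<sigma> \<in> words" "\<sigma> \<noteq> []"
    and max: "\<And>w. w \<in> words \<Longrightarrow> w \<noteq> [] \<Longrightarrow> card (neighbours R w) \<le> card (neighbours R \<sigma>)"
    using ex_has_greatest_nat[of "\<lambda>w. w \<in> words \<and> w \<noteq> []" "[1]" "\<lambda>w. card (neighbours R w)" "Suc M"]
      M less_Suc_eq_le by metis
  \<comment> \<open>\<open>wmap u\<close> scales everything in the neighbour condition by
    \<open>ratio u\<close>, so prefixing sends neighbours of \<open>\<sigma>\<close> injectively to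
    neighbours of \<open>u @ \<sigma>\<close>; maximality of the count leaves no others.\<close>
  have prefixed: "(@) u ` neighbours R \<sigma> = neighbours R (u @ \<sigma>)" if u: "u \<in> words" for u
  proof (rule card_seteq)
    have w: "u @ \<sigma> \<in> words" using u \<sigma> by simp
    show "finite (neighbours R (u @ \<sigma>))" using M[OF w] by blast
    have "card ((@) u ` neighbours R \<sigma>) = card (neighbours R \<sigma>)"
      by (intro card_image inj_onI) simp
    then show "card (neighbours R (u @ \<sigma>)) \<le> card ((@) u ` neighbours R \<sigma>)"
      using max[OF w] \<sigma>(2) by simp
    show "(@) u ` neighbours R \<sigma> \<subseteq> neighbours R (u @ \<sigma>)"
    proof
      fix v' assume "v' \<in> (@) u ` neighbours R \<sigma>"
      then obtain v x y where v: "v' = u @ v" "v \<in> words" "v \<noteq> []" "ratio v \<le> ratio \<sigma>"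
        "ratio \<sigma> < ratio (butlast v)" "x \<in> cball 0 R" "y \<in> cball 0 R"
        "dist (wmap v x) (wmap \<sigma> y) < ratio \<sigma>"
        unfolding neighbours_def by blast
      have "dist (wmap (u @ v) x) (wmap (u @ \<sigma>) y) < ratio (u @ \<sigma>)"
        using v(8) by (simp add: wmap_append dist_wmap[OF u] ratio_pos[OF u])
      then have "\<exists>x\<in>cball 0 R. \<exists>y\<in>cball 0 R. dist (wmap (u @ v) x) (wmap (u @ \<sigma>) y) < ratio (u @ \<sigma>)"
        using v(6,7) by blast
      then show "v' \<in> neighbours R (u @ \<sigma>)"
        unfolding neighbours_def using v(1-7) u ratio_pos[OF u]
        by (auto simp: butlast_append simp del: mem_cball_0)
    qed
  qed
  \<comment> \<open>The word \<open>u\<close> has the larger ratio. If the two cores were too close,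
    an initial part of \<open>v @ \<sigma>\<close> would be a neighbour of
    \<open>u @ \<sigma>\<close> and hence begin with \<open>u\<close>, against
    \<open>u \<parallel> v\<close>.\<close>
  have key: "ratio \<sigma> * ratio u \<le> dist (wmap u (wmap \<sigma> x)) (wmap v (wmap \<sigma> y))"
    if uv: "u \<in> words" "v \<in> words" "u \<parallel> v" "ratio v \<le> ratio u" and xy: "x \<in> cball 0 R" "y \<in> cball 0 R"
    for u v x y
  proof (rule ccontr)
    assume "\<not> ?thesis"
    then have lt: "dist (wmap (v @ \<sigma>) y) (wmap (u @ \<sigma>) x) < ratio (u @ \<sigma>)"
      by (simp add: wmap_append dist_commute mult.commute)
    define \<tau> where "\<tau> = v @ \<sigma>"
    have \<tau>: "\<tau> \<in> words" using uv \<sigma> by (simp add: \<tau>_def)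
    \<comment> \<open>The cut of \<open>\<tau>\<close> at the scale of \<open>u @ \<sigma>\<close>;
      it exists because \<open>ratio v \<le> ratio u\<close>.\<close>
    define k where "k = (LEAST k. ratio (take k \<tau>) \<le> ratio (u @ \<sigma>))"
    have ex: "ratio (take (length \<tau>) \<tau>) \<le> ratio (u @ \<sigma>)"
      using uv(4) ratio_pos[OF \<sigma>(1)] by (simp add: \<tau>_def)
    have k1: "ratio (take k \<tau>) \<le> ratio (u @ \<sigma>)" unfolding k_def by (rule LeastI[of _ "length \<tau>"], rule ex)
    have kl: "k \<le> length \<tau>" unfolding k_def by (rule Least_le, rule ex)
    \<comment> \<open>A ratio below 1 rules out the empty cut, which has ratio 1 and is no stopping
      word.\<close>
    have "ratio (u @ \<sigma>) < 1" using ratio_less_1[of "u @ \<sigma>"] uv \<sigma> by auto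
    with k1 have "k \<noteq> 0" by (cases k) auto
    then obtain j where j: "k = Suc j" by (cases k) auto
    have k2: "ratio (u @ \<sigma>) < ratio (take j \<tau>)"
      using not_less_Least[of j "\<lambda>k. ratio (take k \<tau>) \<le> ratio (u @ \<sigma>)"] j by (simp add: k_def)
    have tw: "take k \<tau> \<in> words" "drop k \<tau> \<in> words" using \<tau> by (auto simp: words_def dest: in_set_takeD in_set_dropD)
    have "wmap \<tau> y = wmap (take k \<tau>) (wmap (drop k \<tau>) y)"
      by (metis append_take_drop_id comp_apply wmap_append)
    moreover have "wmap (drop k \<tau>) y \<in> cball 0 R"
      using wmap_invariant[OF inv[OF R(1)] tw(2) xy(2)] by simp
    moreover have "butlast (take k \<tau>) = take j \<tau>" using kl j by (simp add: butlast_take)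
    moreover have "take k \<tau> \<noteq> []" using kl j by auto
    moreover have "\<exists>x'\<in>cball 0 R. \<exists>y'\<in>cball 0 R. dist (wmap (take k \<tau>) x') (wmap (u @ \<sigma>) y') < ratio (u @ \<sigma>)"
      using lt calculation(1,2) xy(1) unfolding \<tau>_def[symmetric] by metis
    ultimately have "take k \<tau> \<in> neighbours R (u @ \<sigma>)"
      unfolding neighbours_def using k1 k2 tw(1) by simp
    then obtain z where "take k \<tau> = u @ z" using prefixed[OF uv(1)] by blast
    then have "prefix u \<tau>" by (metis prefixI append_take_drop_id append.assoc)
    moreover have "prefix v \<tau>" by (simp add: \<tau>_def)
    ultimately show False using uv(3) prefix_same_cases by blast
  qed
  show ?thesis
  \<comment> \<open>\<open>key\<close> separates by \<open>ratio \<sigma>\<close> times the larger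
    ratio, which is at least half the sum. The symmetric form fits the triangle inequality through a
    common quantizer point later on.\<close>
  proof (rule that[OF R \<sigma>(1), of "ratio \<sigma> / 2"])
    show "ratio \<sigma> / 2 > 0" using ratio_pos[OF \<sigma>(1)] by simp
    fix u v x y assume h: "u \<in> words" "v \<in> words" "u \<parallel> v" "x \<in> wmap \<sigma> ` cball 0 R"
      "y \<in> wmap \<sigma> ` cball 0 R"
    then obtain x' y' where x': "x' \<in> cball 0 R" "x = wmap \<sigma> x'" and y': "y' \<in> cball 0 R" "y = wmap \<sigma> y'"
      by blast
    have *: "ratio \<sigma> / 2 * (ratio u + ratio v) \<le> ratio \<sigma> * max (ratio u) (ratio v)"
      using ratio_pos[OF \<sigma>(1)] by (auto simp: max_def)
    show "ratio \<sigma> / 2 * (ratio u + ratio v) \<le> dist (wmap u x) (wmap v y)"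
    proof (cases "ratio v \<le> ratio u")
      case True
      then show ?thesis using key[OF h(1,2,3) _ x'(1) y'(1)] * x' y' by (simp add: max_def)
    next
      case False
      then show ?thesis using key[of v u y' x'] h * x' y'
        by (simp add: max_def parallel_commute dist_commute)
    qed
  qed
qed

end

section \<open>Invariance of integrals and bounded support\<close>

text \<open>Serves both defining equations: an identity on Borel sets passes to non-negative Borel
  functions by the usual induction. The family \<open>K\<close> may mix different measures, as the
  equation for \<open>\<mu>\<close> requires.\<close>

lemma nn_integral_weighted_sum:
  assumes M: "sets M = sets borel" "\<And>j. j \<in> J \<Longrightarrow> sets (K j) = sets borel"
    and E: "\<And>A. A \<in> sets borel \<Longrightarrow> emeasure M A = (\<Sum>j\<in>J. c j * emeasure (K j) A)"
    and g: "g \<in> borel_measurable borel"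
  shows "(\<integral>\<^sup>+x. g x \<partial>M) = (\<Sum>j\<in>J. c j * (\<integral>\<^sup>+x. g x \<partial>K j))"
proof -
  have bM: "borel_measurable M = (borel_measurable borel :: (_ \<Rightarrow> ennreal) set)"
    by (rule measurable_cong_sets[OF M(1) refl])
  have bK: "borel_measurable (K j) = (borel_measurable borel :: (_ \<Rightarrow> ennreal) set)" if "j \<in> J" for j
    by (rule measurable_cong_sets[OF M(2)[OF that] refl])
  have "g \<in> borel_measurable M" using bM g by simp
  then show ?thesis
  proof (induction rule: borel_measurable_induct)
    case (cong u v)
    then have "u = v" using sets_eq_imp_space_eq[OF M(1)] by auto
    with cong show ?case by simp
  next
    case (set A)
    then show ?case using E M by (simp add: nn_integral_indicator)
  next
    case (mult u c)
    then show ?case using bM bK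
      by (simp add: nn_integral_cmult sum_distrib_left mult.left_commute)
  next
    case (add u v)
    then show ?case using bM bK
      by (simp add: nn_integral_add sum.distrib distrib_left)
  next
    case (seq U)
    have U: "U i \<in> borel_measurable M" "j \<in> J \<Longrightarrow> U i \<in> borel_measurable (K j)" for i j
      using seq(1) bM bK by simp_all
    have inc: "incseq U" by fact
    have "(\<integral>\<^sup>+x. (SUP i. U i) x \<partial>M) = (SUP i. \<integral>\<^sup>+x. U i x \<partial>M)"
      using nn_integral_monotone_convergence_SUP[OF inc U(1)] by (simp add: image_comp)
    also have "\<dots> = (SUP i. \<Sum>j\<in>J. c j * (\<integral>\<^sup>+x. U i x \<partial>K j))"
      using seq.IH by simp
    also have "\<dots> = (\<Sum>j\<in>J. SUP i. c j * (\<integral>\<^sup>+x. U i x \<partial>K j))"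
    proof (rule ennreal_SUP_sum)
      show "incseq (\<lambda>i. c j * (\<integral>\<^sup>+x. U i x \<partial>K j))" for j
        using inc by (auto simp: incseq_def le_fun_def intro!: mult_left_mono nn_integral_mono)
    qed
    also have "\<dots> = (\<Sum>j\<in>J. c j * (\<integral>\<^sup>+x. (SUP i. U i) x \<partial>K j))"
    proof (rule sum.cong[OF refl])
      fix j assume "j \<in> J"
      then have "(\<integral>\<^sup>+x. (SUP i. U i) x \<partial>K j) = (SUP i. \<integral>\<^sup>+x. U i x \<partial>K j)"
        using nn_integral_monotone_convergence_SUP[OF inc U(2)] by (simp add: image_comp)
      then show "(SUP i. c j * (\<integral>\<^sup>+x. U i x \<partial>K j)) = c j * (\<integral>\<^sup>+x. (SUP i. U i) x \<partial>K j)"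
        by (simp add: SUP_mult_left_ennreal)
    qed
    finally show ?case .
  qed
qed

lemma infdist_powr_measurable:
  "(\<lambda>x. ennreal (infdist x \<alpha> powr r)) \<in> borel_measurable borel"
proof -
  have "(\<lambda>x. infdist x \<alpha>) \<in> borel_measurable borel"
    by (intro borel_measurable_continuous_onI continuous_on_infdist continuous_on_id)
  then show ?thesis by measurable
qed

context similitude_system
begin

lemma self_similar_nn_integral:
  assumes "self_similar_measure N f t \<nu>" and g: "g \<in> borel_measurable borel"
  shows "(\<integral>\<^sup>+x. g x \<partial>\<nu>) = (\<Sum>i=1..N. ennreal (t i) * (\<integral>\<^sup>+x. g (f i x) \<partial>\<nu>))"
proof -
  have \<nu>: "sets \<nu> = sets borel"
    using assms(1) by (simp add: self_similar_measure_def borel_probability_measure_def)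
  then have f: "f i \<in> measurable \<nu> borel" if "i \<in> {1..N}" for i
    using measurable_f[OF that] measurable_cong_sets by blast
  have "space \<nu> = UNIV" using sets_eq_imp_space_eq[OF \<nu>] by simp
  then have "(\<integral>\<^sup>+x. g x \<partial>\<nu>) = (\<Sum>i=1..N. ennreal (t i) * (\<integral>\<^sup>+x. g x \<partial>distr \<nu> borel (f i)))"
    using assms(1) \<nu> f g
    by (intro nn_integral_weighted_sum) (auto simp: self_similar_measure_def emeasure_distr)
  then show ?thesis using f g by (simp add: nn_integral_distr)
qed

lemma inhomogeneous_nn_integral:
  assumes "inhomogeneous_self_similar_measure N f p \<nu> \<mu>" "sets \<nu> = sets borel"
    and g: "g \<in> borel_measurable borel"
  shows "(\<integral>\<^sup>+x. g x \<partial>\<mu>) = ennreal (p 0) * (\<integral>\<^sup>+x. g x \<partial>\<nu>)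
    + (\<Sum>i=1..N. ennreal (p i) * (\<integral>\<^sup>+x. g (f i x) \<partial>\<mu>))"
proof -
  have \<mu>: "sets \<mu> = sets borel"
    using assms(1) by (simp add: inhomogeneous_self_similar_measure_def borel_probability_measure_def)
  then have f: "f i \<in> measurable \<mu> borel" if "i \<in> {1..N}" for i
    using measurable_f[OF that] measurable_cong_sets by blast
  define K where "K i = (if i = 0 then \<nu> else distr \<mu> borel (f i))" for i
  have split: "(\<Sum>i\<in>{0..N}. h i) = h 0 + (\<Sum>i=1..N. h i)" for h :: "nat \<Rightarrow> ennreal"
    by (simp add: sum.atLeast_Suc_atMost)
  have sp: "space \<mu> = UNIV" using sets_eq_imp_space_eq[OF \<mu>] by simp
  have "(\<integral>\<^sup>+x. g x \<partial>\<mu>) = (\<Sum>i\<in>{0..N}. ennreal (p i) * (\<integral>\<^sup>+x. g x \<partial>K i))"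
  proof (rule nn_integral_weighted_sum[OF \<mu> _ _ g])
    show "sets (K j) = sets borel" for j using assms(2) by (simp add: K_def)
    fix A :: "'a set" assume A: "A \<in> sets borel"
    have "(\<Sum>i=1..N. ennreal (p i) * emeasure (K i) A) = (\<Sum>i=1..N. ennreal (p i) * emeasure \<mu> (f i -` A))"
      using f A sp by (intro sum.cong refl) (auto simp: K_def emeasure_distr)
    then show "emeasure \<mu> A = (\<Sum>i\<in>{0..N}. ennreal (p i) * emeasure (K i) A)"
      using assms(1) A unfolding split by (simp add: inhomogeneous_self_similar_measure_def K_def)
  qed
  also have "\<dots> = ennreal (p 0) * (\<integral>\<^sup>+x. g x \<partial>\<nu>)
    + (\<Sum>i=1..N. ennreal (p i) * (\<integral>\<^sup>+x. g x \<partial>K i))"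
    unfolding split by (simp add: K_def)
  also have "(\<Sum>i=1..N. ennreal (p i) * (\<integral>\<^sup>+x. g x \<partial>K i)) = (\<Sum>i=1..N. ennreal (p i) * (\<integral>\<^sup>+x. g (f i x) \<partial>\<mu>))"
    using f g by (intro sum.cong refl) (auto simp: K_def nn_integral_distr)
  finally show ?thesis .
qed

lemma norm_f_le: "i \<in> {1..N} \<Longrightarrow> norm (f i x) \<le> norm (f i 0) + s i * norm x"
  by (metis dist_f add_left_mono diff_zero dist_norm norm_triangle_sub order_refl)

text \<open>Boundedness of the support is derived from the equation. The mass outside a ball is at
  most the mass outside a larger ball, whose excess radius over \<open>R0\<close> has grown by the
  factor \<open>1 / c\<close>; iterated, the outer sets shrink to the empty set.\<close>

lemma self_similar_support:
  assumes \<nu>: "self_similar_measure N f t \<nu>" and t: "positive_probability_vector {1..N} t" and N: "N \<ge> 1"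
    and R0: "\<And>i. i \<in> {1..N} \<Longrightarrow> norm (f i 0) + s i * R0 \<le> R0" and R: "R0 < R"
  shows "emeasure \<nu> {x. norm x > R} = 0"
proof -
  interpret prob_space \<nu>
    using \<nu> by (simp add: self_similar_measure_def borel_probability_measure_def)
  have sets: "sets \<nu> = sets borel"
    using \<nu> by (simp add: self_similar_measure_def borel_probability_measure_def)
  define c where "c = Max (s ` {1..N})"
  have c: "0 < c" "c < 1" "\<And>i. i \<in> {1..N} \<Longrightarrow> s i \<le> c"
  proof -
    have "c \<in> s ` {1..N}" unfolding c_def using N by (intro Max_in) auto
    then show "0 < c" "c < 1" using s_pos s_less_1 by auto
    show "\<And>i. i \<in> {1..N} \<Longrightarrow> s i \<le> c" unfolding c_def by (intro Max_ge) auto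
  qed
  \<comment> \<open>The start strictly above \<open>R0\<close> is essential: from \<open>R0\<close>
    itself the radii would not grow.\<close>
  define \<rho> where "\<rho> k = R0 + (R - R0) * (1 / c) ^ k" for k :: nat
  define G where "G k = {x :: 'a. norm x > \<rho> k}" for k
  have Gm: "G k \<in> sets borel" for k
    unfolding G_def by (intro borel_open open_Collect_less continuous_intros)
  have step: "emeasure \<nu> (G k) \<le> emeasure \<nu> (G (Suc k))" for k
  proof -
    have sub: "f i -` G k \<subseteq> G (Suc k)" if i: "i \<in> {1..N}" for i
    proof
      fix x assume x: "x \<in> f i -` G k"
      show "x \<in> G (Suc k)"
      proof (rule ccontr)
        assume "x \<notin> G (Suc k)"
        then have "norm x \<le> \<rho> (Suc k)" by (simp add: G_def)
        then have "s i * norm x \<le> s i * R0 + s i * ((R - R0) * (1 / c) ^ Suc k)"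
          using s_pos[OF i] unfolding \<rho>_def by (metis distrib_left less_imp_le mult_left_mono)
        also have "s i * ((R - R0) * (1 / c) ^ Suc k) \<le> c * ((R - R0) * (1 / c) ^ Suc k)"
          using c(1) c(3)[OF i] R by (intro mult_right_mono) auto
        also have "\<dots> = (R - R0) * (1 / c) ^ k" using c(1) by simp
        finally have "norm (f i x) \<le> \<rho> k" using norm_f_le[OF i, of x] R0[OF i] by (simp add: \<rho>_def)
        with x show False by (simp add: G_def)
      qed
    qed
    have "emeasure \<nu> (G k) = (\<Sum>i=1..N. ennreal (t i) * emeasure \<nu> (f i -` G k))"
      using \<nu> Gm by (simp add: self_similar_measure_def)
    also have "\<dots> \<le> (\<Sum>i=1..N. ennreal (t i) * emeasure \<nu> (G (Suc k)))"
      using sub Gm sets by (intro sum_mono mult_left_mono emeasure_mono) auto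
    also have "\<dots> = ennreal (\<Sum>i=1..N. t i) * emeasure \<nu> (G (Suc k))"
      using t by (subst sum_ennreal[symmetric])
        (auto simp: positive_probability_vector_def less_imp_le sum_distrib_right)
    finally show ?thesis using t by (simp add: positive_probability_vector_def)
  qed
  have le: "emeasure \<nu> (G 0) \<le> emeasure \<nu> (G k)" for k
    by (induction k) (auto intro: order_trans[OF _ step])
  have dec: "decseq G"
  proof (rule decseq_SucI)
    fix k
    have "(1 / c) ^ k \<le> (1 / c) ^ Suc k" using c by (intro power_increasing) auto
    then have "\<rho> k \<le> \<rho> (Suc k)" unfolding \<rho>_def using R by (intro add_left_mono mult_left_mono) auto
    then show "G (Suc k) \<le> G k" by (auto simp: G_def)
  qed
  have "(\<lambda>k. emeasure \<nu> (G k)) \<longlonglongrightarrow> emeasure \<nu> (\<Inter>k. G k)"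
    using Gm sets dec by (intro Lim_emeasure_decseq) (auto simp: emeasure_eq_measure)
  moreover have "(\<Inter>k. G k) = {}"
  proof -
    have "x \<notin> (\<Inter>k. G k)" for x
    proof -
      obtain k where "(norm x - R0) / (R - R0) < (1 / c) ^ k"
        using real_arch_pow[of "1/c"] c by auto
      then have "norm x \<le> \<rho> k" using R by (simp add: \<rho>_def pos_divide_less_eq mult.commute)
      then have "x \<notin> G k" by (simp add: G_def)
      then show ?thesis by blast
    qed
    then show ?thesis by blast
  qed
  ultimately have "(\<lambda>k. emeasure \<nu> (G k)) \<longlonglongrightarrow> 0" by simp
  then have "emeasure \<nu> (G 0) \<le> 0" using le by (intro LIMSEQ_le_const) auto
  then show ?thesis by (simp add: G_def \<rho>_def)
qed

text \<open>No iteration this time: the outer set contains its preimages and is null for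
  \<open>\<nu>\<close>, so its mass is at most \<open>1 - p 0\<close> times itself, which forces it
  to vanish.\<close>

lemma inhomogeneous_support:
  assumes \<mu>: "inhomogeneous_self_similar_measure N f p \<nu> \<mu>" and p: "positive_probability_vector {0..N} p"
    and R: "\<And>i. i \<in> {1..N} \<Longrightarrow> norm (f i 0) + s i * R \<le> R" and \<nu>: "emeasure \<nu> {x. norm x > R} = 0"
  shows "emeasure \<mu> {x. norm x > R} = 0"
proof -
  interpret prob_space \<mu>
    using \<mu> by (simp add: inhomogeneous_self_similar_measure_def borel_probability_measure_def)
  have sets: "sets \<mu> = sets borel"
    using \<mu> by (simp add: inhomogeneous_self_similar_measure_def borel_probability_measure_def)
  define G where "G = {x :: 'a. norm x > R}"
  have Gm: "G \<in> sets borel"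
    unfolding G_def by (intro borel_open open_Collect_less continuous_intros)
  have sub: "f i -` G \<subseteq> G" if i: "i \<in> {1..N}" for i
    using cball_invariantI[OF R[OF i] i] by (force simp: G_def subset_iff not_less[symmetric])
  have p0: "p 0 > 0" "\<And>i. i \<in> {1..N} \<Longrightarrow> p i > 0" "(\<Sum>i=1..N. p i) = 1 - p 0"
    using p by (auto simp: positive_probability_vector_def sum.atLeast_Suc_atMost)
  have "emeasure \<mu> G = ennreal (p 0) * emeasure \<nu> G + (\<Sum>i=1..N. ennreal (p i) * emeasure \<mu> (f i -` G))"
    using \<mu> Gm by (simp add: inhomogeneous_self_similar_measure_def)
  also have "\<dots> \<le> (\<Sum>i=1..N. ennreal (p i) * emeasure \<mu> G)"
    unfolding \<nu>[folded G_def] mult_zero_right add_0_left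
    by (intro sum_mono mult_left_mono emeasure_mono sub) (auto simp: Gm sets)
  also have "\<dots> = ennreal (\<Sum>i=1..N. p i) * emeasure \<mu> G"
    using p0 by (subst sum_ennreal[symmetric]) (auto simp: less_imp_le sum_distrib_right)
  finally have "ennreal (measure \<mu> G) \<le> ennreal ((1 - p 0) * measure \<mu> G)"
    unfolding p0(3) emeasure_eq_measure by (simp add: ennreal_mult'')
  moreover have "1 - p 0 \<ge> 0" unfolding p0(3)[symmetric] using p0(2) by (intro sum_nonneg) (auto simp: less_imp_le)
  ultimately have "measure \<mu> G \<le> (1 - p 0) * measure \<mu> G" by (simp add: ennreal_le_iff)
  then have "p 0 * measure \<mu> G \<le> 0" by (simp add: algebra_simps)
  then have "measure \<mu> G = 0" using p0(1) by (simp add: mult_le_0_iff antisym)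
  then show ?thesis by (simp add: emeasure_eq_measure G_def)
qed

section \<open>Lower bounds\<close>

text \<open>This inequality is the common feature behind the lower bounds: \<open>\<nu>\<close>
  satisfies it with the weights \<open>t\<close>, and \<open>\<mu>\<close> with \<open>p\<close>
  after the term with \<open>\<nu>\<close> is dropped.\<close>

definition superinvariant :: "(nat \<Rightarrow> real) \<Rightarrow> 'a measure \<Rightarrow> bool" where
  "superinvariant q P \<longleftrightarrow> (\<forall>g\<in>borel_measurable borel.
     (\<Sum>i=1..N. ennreal (q i) * (\<integral>\<^sup>+x. g (f i x) \<partial>P)) \<le> (\<integral>\<^sup>+x. g x \<partial>P))"

text \<open>Supplies the positive mass of the core. The preimage under \<open>f i\<close> of the
  image under \<open>i # w\<close> contains the image under \<open>w\<close>, so a letter costs at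
  most a positive factor; compactness makes all images Borel.\<close>

lemma superinvariant_wmap_pos:
  assumes P: "superinvariant q P" "sets P = sets borel" and q: "\<And>i. i \<in> {1..N} \<Longrightarrow> q i > 0"
    and C: "compact C" "emeasure P C > 0" and w: "w \<in> words"
  shows "emeasure P (wmap w ` C) > 0"
  using w
proof (induction w)
  case Nil
  then show ?case using C by simp
next
  case (Cons i w)
  then have i: "i \<in> {1..N}" and w: "w \<in> words" by auto
  have cp: "compact (wmap v ` C)" if "v \<in> words" for v
    using C(1) continuous_wmap[OF that] by (intro compact_continuous_image) (auto intro: continuous_on_subset)
  then have m: "wmap v ` C \<in> sets borel" if "v \<in> words" for v
    using that by (simp add: borel_compact)
  let ?g = "indicator (wmap (i # w) ` C) :: 'a \<Rightarrow> ennreal"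
  have "0 < ennreal (q i) * emeasure P (wmap w ` C)"
    using Cons q[OF i] w by (simp add: ennreal_zero_less_mult_iff)
  also have "\<dots> = ennreal (q i) * (\<integral>\<^sup>+x. indicator (wmap w ` C) x \<partial>P)"
    using m[OF w] P(2) by simp
  also have "\<dots> \<le> ennreal (q i) * (\<integral>\<^sup>+x. ?g (f i x) \<partial>P)"
    by (intro mult_left_mono nn_integral_mono) (auto split: split_indicator)
  also have "\<dots> \<le> (\<Sum>i=1..N. ennreal (q i) * (\<integral>\<^sup>+x. ?g (f i x) \<partial>P))"
    using i by (intro member_le_sum) auto
  also have "\<dots> \<le> (\<integral>\<^sup>+x. ?g x \<partial>P)"
    using P(1) m[OF Cons.prems] unfolding superinvariant_def by (metis borel_measurable_indicator)
  also have "\<dots> = emeasure P (wmap (i # w) ` C)"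
    using m[OF Cons.prems] P(2) by (simp only: nn_integral_indicator)
  finally show ?case .
qed

text \<open>\<open>\<Phi>\<close> stands for integration against a measure that dominates the
  weighted images of \<open>P\<close>; as a functional it spares the construction of the levels as
  measures. The product \<open>q w * ratio w powr r\<close> is the error scale of one piece, bounded
  below uniformly over the antichain.\<close>

definition weighted_cut ::
  "'a measure \<Rightarrow> real \<Rightarrow> real \<Rightarrow> real \<Rightarrow> real \<Rightarrow> (('a \<Rightarrow> ennreal) \<Rightarrow> ennreal) \<Rightarrow>
    nat list set \<Rightarrow> (nat list \<Rightarrow> real) \<Rightarrow> bool" where
  "weighted_cut P r c \<theta> x \<Phi> A q \<longleftrightarrow>
     finite A \<and> A \<subseteq> words \<and> (\<forall>u\<in>A. \<forall>v\<in>A. u \<noteq> v \<longrightarrow> u \<parallel> v) \<and> x \<le> real (card A) \<and>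
     (\<forall>w\<in>A. 0 \<le> q w \<and> c * x powr (-\<theta>) \<le> q w * ratio w powr r) \<and>
     (\<forall>g\<in>borel_measurable borel. (\<Sum>w\<in>A. ennreal (q w) * (\<integral>\<^sup>+y. g (wmap w y) \<partial>P)) \<le> \<Phi> g)"

definition cut_bound ::
  "'a measure \<Rightarrow> real \<Rightarrow> real \<Rightarrow> real \<Rightarrow> real \<Rightarrow> (('a \<Rightarrow> ennreal) \<Rightarrow> ennreal) \<Rightarrow> bool" where
  "cut_bound P r c \<theta> x \<Phi> \<longleftrightarrow> (\<exists>A q. weighted_cut P r c \<theta> x \<Phi> A q)"

lemma weighted_cutD:
  assumes "weighted_cut P r c \<theta> x \<Phi> A q"
  shows "finite A" "A \<subseteq> words" "\<And>u v. u \<in> A \<Longrightarrow> v \<in> A \<Longrightarrow> u \<noteq> v \<Longrightarrow> u \<parallel> v"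
    "x \<le> real (card A)" "\<And>w. w \<in> A \<Longrightarrow> 0 \<le> q w"
    "\<And>w. w \<in> A \<Longrightarrow> c * x powr (-\<theta>) \<le> q w * ratio w powr r"
    "\<And>g. g \<in> borel_measurable borel \<Longrightarrow> (\<Sum>w\<in>A. ennreal (q w) * (\<integral>\<^sup>+y. g (wmap w y) \<partial>P)) \<le> \<Phi> g"
  using assms unfolding weighted_cut_def by simp_all

text \<open>For \<open>x \<le> 1\<close> the empty word alone is enough. The constant
  \<open>m powr \<theta>\<close> keeps the demanded bound at or below the weight 1 of that word for
  all \<open>x\<close> between \<open>m\<close> and 1.\<close>

lemma cut_bound_init:
  assumes "0 < m" "m \<le> x" "x \<le> 1" "0 \<le> \<theta>"
  shows "cut_bound P r (m powr \<theta>) \<theta> x (nn_integral P)"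
proof -
  have "m powr \<theta> * x powr (-\<theta>) \<le> x powr \<theta> * x powr (-\<theta>)"
    using assms by (intro mult_right_mono powr_mono2) auto
  also have "\<dots> = 1" using assms by (simp add: powr_add[symmetric])
  finally have "weighted_cut P r (m powr \<theta>) \<theta> x (nn_integral P) {[]} (\<lambda>_. 1)"
    using assms by (auto simp: weighted_cut_def)
  then show ?thesis unfolding cut_bound_def by blast
qed

lemma cut_bound_mono:
  assumes "cut_bound P r c \<theta> x \<Phi>" "\<And>g. g \<in> borel_measurable borel \<Longrightarrow> \<Phi> g \<le> \<Phi>' g"
  shows "cut_bound P r c \<theta> x \<Phi>'"
proof -
  obtain A q where "weighted_cut P r c \<theta> x \<Phi> A q" using assms(1) unfolding cut_bound_def by blast
  then have "weighted_cut P r c \<theta> x \<Phi>' A q"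
    using assms(2) unfolding weighted_cut_def by (auto intro: order_trans)
  then show ?thesis unfolding cut_bound_def by blast
qed

text \<open>The cut for the budget \<open>x * b i\<close> is prefixed by the letter
  \<open>i\<close>. The sizes add up to at least \<open>x\<close>, and the new factor
  \<open>p i * s i powr r = b i powr \<theta>\<close> cancels \<open>b i powr (-\<theta>)\<close>,
  so \<open>c\<close> is not worsened.\<close>

lemma cut_bound_step:
  assumes cut: "\<And>i. i \<in> {1..N} \<Longrightarrow> cut_bound P r c \<theta> (x * b i) \<Phi>"
    and b: "\<And>i. i \<in> {1..N} \<Longrightarrow> 0 < b i" "\<And>i. i \<in> {1..N} \<Longrightarrow> b i powr \<theta> = p i * s i powr r"
      "1 \<le> (\<Sum>i=1..N. b i)"
    and x: "0 < x" and p: "\<And>i. i \<in> {1..N} \<Longrightarrow> 0 \<le> p i"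
  shows "cut_bound P r c \<theta> x (\<lambda>g. \<Sum>i=1..N. ennreal (p i) * \<Phi> (\<lambda>y. g (f i y)))"
proof -
  have "\<forall>i\<in>{1..N}. \<exists>A q. weighted_cut P r c \<theta> (x * b i) \<Phi> A q"
    using cut unfolding cut_bound_def by blast
  then obtain A where "\<forall>i\<in>{1..N}. \<exists>q. weighted_cut P r c \<theta> (x * b i) \<Phi> (A i) q"
    using bchoice[of "{1..N}" "\<lambda>i A. \<exists>q. weighted_cut P r c \<theta> (x * b i) \<Phi> A q"] by blast
  then obtain q where "\<forall>i\<in>{1..N}. weighted_cut P r c \<theta> (x * b i) \<Phi> (A i) (q i)"
    using bchoice[of "{1..N}" "\<lambda>i q. weighted_cut P r c \<theta> (x * b i) \<Phi> (A i) q"] by blast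
  then have Aq: "\<And>i. i \<in> {1..N} \<Longrightarrow> weighted_cut P r c \<theta> (x * b i) \<Phi> (A i) (q i)" by blast
  note A = weighted_cutD[OF Aq]
  define A' where "A' = (\<lambda>(i, w). i # w) ` (SIGMA i:{1..N}. A i)"
  define q' where "q' w = p (hd w) * q (hd w) (tl w)" for w
  have inj: "inj_on (\<lambda>(i, w). i # w) (SIGMA i:{1..N}. A i)" by (auto intro!: inj_onI)
  have 1: "x \<le> real (card A')"
  proof -
    have "x * 1 \<le> x * (\<Sum>i=1..N. b i)" using b(3) x by (intro mult_left_mono) auto
    also have "\<dots> \<le> (\<Sum>i=1..N. real (card (A i)))"
      unfolding sum_distrib_left using A(4) by (intro sum_mono) auto
    also have "\<dots> = real (card A')"
      unfolding A'_def using A(1) by (subst card_image[OF inj]) (auto simp: card_SigmaI)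
    finally show ?thesis by simp
  qed
  have 2: "0 \<le> q' w \<and> c * x powr (-\<theta>) \<le> q' w * ratio w powr r" if wA: "w \<in> A'" for w
  proof -
    obtain i v where w: "w = i # v" "i \<in> {1..N}" "v \<in> A i" using wA by (auto simp: A'_def)
    have bp: "b i powr \<theta> * b i powr (-\<theta>) = 1"
      using b(1)[OF w(2)] by (simp add: powr_add[symmetric])
    have "c * x powr (-\<theta>) = b i powr \<theta> * (c * (x * b i) powr (-\<theta>))"
      using x b(1)[OF w(2)] bp by (simp add: powr_mult mult_ac)
    also have "\<dots> \<le> b i powr \<theta> * (q i v * ratio v powr r)"
      using A(6)[OF w(2,3)] by (intro mult_left_mono) auto
    also have "\<dots> = q' w * ratio w powr r"
      using s_pos[OF w(2)] ratio_pos[of v] A(2) w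
      by (simp add: b(2)[OF w(2)] q'_def w(1) powr_mult subset_iff mult_ac less_imp_le)
    finally show ?thesis using A(5)[OF w(2,3)] p[OF w(2)] by (simp add: q'_def w(1))
  qed
  have 3: "(\<Sum>w\<in>A'. ennreal (q' w) * (\<integral>\<^sup>+y. g (wmap w y) \<partial>P)) \<le> (\<Sum>i=1..N. ennreal (p i) * \<Phi> (\<lambda>y. g (f i y)))"
    if g: "g \<in> borel_measurable borel" for g
  proof -
    have "(\<Sum>w\<in>A'. ennreal (q' w) * (\<integral>\<^sup>+y. g (wmap w y) \<partial>P))
      = (\<Sum>(i, w)\<in>(SIGMA i:{1..N}. A i). ennreal (p i * q i w) * (\<integral>\<^sup>+y. g (f i (wmap w y)) \<partial>P))"
      unfolding A'_def sum.reindex[OF inj] by (intro sum.cong refl) (auto simp: q'_def)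
    also have "\<dots> = (\<Sum>i=1..N. \<Sum>w\<in>A i. ennreal (p i * q i w) * (\<integral>\<^sup>+y. g (f i (wmap w y)) \<partial>P))"
      using A(1) by (subst sum.Sigma) auto
    also have "\<dots> = (\<Sum>i=1..N. ennreal (p i) * (\<Sum>w\<in>A i. ennreal (q i w) * (\<integral>\<^sup>+y. g (f i (wmap w y)) \<partial>P)))"
      using A(5) p by (intro sum.cong refl) (auto simp: sum_distrib_left ennreal_mult mult.assoc intro!: sum.cong)
    also have "\<dots> \<le> (\<Sum>i=1..N. ennreal (p i) * \<Phi> (\<lambda>y. g (f i y)))"
    proof (intro sum_mono mult_left_mono)
      fix i assume i: "i \<in> {1..N}"
      have "(\<lambda>y. g (f i y)) \<in> borel_measurable borel"
        using measurable_compose[OF measurable_f[OF i] g] .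
      then show "(\<Sum>w\<in>A i. ennreal (q i w) * (\<integral>\<^sup>+y. g (f i (wmap w y)) \<partial>P)) \<le> \<Phi> (\<lambda>y. g (f i y))"
        using A(7)[OF i] by blast
    qed simp
    finally show ?thesis .
  qed
  have "u \<parallel> v" if "u \<in> A'" "v \<in> A'" "u \<noteq> v" for u v
    using that A(3) unfolding A'_def parallel_def by auto blast+
  moreover have "finite A'" unfolding A'_def using A(1) by (intro finite_imageI finite_SigmaI) auto
  moreover have "A' \<subseteq> words"
  proof
    fix w assume "w \<in> A'"
    then obtain i v where "w = i # v" "i \<in> {1..N}" "v \<in> A i" by (auto simp: A'_def)
    then show "w \<in> words" using A(2)[of i] by auto
  qed
  ultimately have "weighted_cut P r c \<theta> x (\<lambda>g. \<Sum>i=1..N. ennreal (p i) * \<Phi> (\<lambda>y. g (f i y))) A' q'"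
    unfolding weighted_cut_def using 1 2 3 by simp
  then show ?thesis unfolding cut_bound_def by blast
qed

text \<open>Induction on the number of factors \<open>\<beta>\<close> that bring \<open>x\<close>
  down to 1. The step may call for values below 1, and \<open>m\<close> limits how far
  below.\<close>

lemma scale_induct:
  fixes x m \<beta> :: real
  assumes \<beta>: "0 < \<beta>" "\<beta> < 1" and x: "m \<le> x"
    and base: "\<And>x. m \<le> x \<Longrightarrow> x \<le> 1 \<Longrightarrow> Q x"
    and step: "\<And>x. 1 < x \<Longrightarrow> (\<And>y. m \<le> y \<Longrightarrow> y \<le> \<beta> * x \<Longrightarrow> Q y) \<Longrightarrow> Q x"
  shows "Q x"
proof -
  have *: "\<forall>x. m \<le> x \<longrightarrow> x * \<beta> ^ n \<le> 1 \<longrightarrow> Q x" for n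
  proof (induction n)
    case 0
    then show ?case using base by simp
  next
    case (Suc n)
    show ?case
    proof (intro allI impI)
      fix x assume x: "m \<le> x" "x * \<beta> ^ Suc n \<le> 1"
      show "Q x"
      proof (cases "x \<le> 1")
        case False
        have "Q y" if "m \<le> y" "y \<le> \<beta> * x" for y
        proof -
          have "y * \<beta> ^ n \<le> \<beta> * x * \<beta> ^ n" using that \<beta> by (intro mult_right_mono) auto
          then show ?thesis using Suc x(2) that(1) by (auto simp: mult_ac)
        qed
        then show ?thesis using step False by simp
      qed (use base x in auto)
    qed
  qed
  have "0 < 1 / max x 1" by simp
  then obtain n where "\<beta> ^ n < 1 / max x 1" using real_arch_pow_inv \<beta>(2) by blast
  then have "max x 1 * \<beta> ^ n \<le> 1" by (simp add: field_simps)
  moreover have "x * \<beta> ^ n \<le> max x 1 * \<beta> ^ n" using \<beta> by (intro mult_right_mono) auto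
  ultimately have "x * \<beta> ^ n \<le> 1" by linarith
  then show ?thesis using *[of n] x by blast
qed

lemma cut_bound_superinvariant:
  assumes P: "superinvariant p P"
    and b: "\<And>i. i \<in> {1..N} \<Longrightarrow> m \<le> b i" "\<And>i. i \<in> {1..N} \<Longrightarrow> b i \<le> \<beta>"
      "\<And>i. i \<in> {1..N} \<Longrightarrow> b i powr \<theta> = p i * s i powr r" "1 \<le> (\<Sum>i=1..N. b i)"
    and m: "0 < m" "0 < \<beta>" "\<beta> < 1" "0 \<le> \<theta>" and p: "\<And>i. i \<in> {1..N} \<Longrightarrow> 0 \<le> p i"
    and x: "m \<le> x"
  shows "cut_bound P r (m powr \<theta>) \<theta> x (nn_integral P)"
proof (rule scale_induct[OF m(2,3) x])
  show "cut_bound P r (m powr \<theta>) \<theta> x (nn_integral P)" if "m \<le> x" "x \<le> 1" for x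
    using cut_bound_init that m by blast
next
  fix x :: real assume x: "1 < x"
    and IH: "\<And>y. m \<le> y \<Longrightarrow> y \<le> \<beta> * x \<Longrightarrow> cut_bound P r (m powr \<theta>) \<theta> y (nn_integral P)"
  have "cut_bound P r (m powr \<theta>) \<theta> (x * b i) (nn_integral P)" if i: "i \<in> {1..N}" for i
  proof (rule IH)
    \<comment> \<open>As \<open>x > 1\<close>, the share is at least \<open>b i\<close>, hence at
      least \<open>m\<close>: the recursion never leaves its range.\<close>
    have "1 * b i \<le> x * b i" using x b(1)[OF i] m(1) by (intro mult_right_mono) auto
    then show "m \<le> x * b i" using b(1)[OF i] by simp
    show "x * b i \<le> \<beta> * x" using x b(2)[OF i] by simp
  qed
  moreover have "0 < b i" if "i \<in> {1..N}" for i using b(1)[OF that] m(1) by simp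
  ultimately have "cut_bound P r (m powr \<theta>) \<theta> x (\<lambda>g. \<Sum>i=1..N. ennreal (p i) * nn_integral P (\<lambda>y. g (f i y)))"
    using x b(3,4) p by (intro cut_bound_step[where b=b]) auto
  then show "cut_bound P r (m powr \<theta>) \<theta> x (nn_integral P)"
    by (rule cut_bound_mono) (use P in \<open>auto simp: superinvariant_def\<close>)
qed

text \<open>Integration against the sum, over the words \<open>w\<close> of length \<open>k\<close>,
  of the images of \<open>P\<close> under \<open>wmap w\<close>, weighted by the products of the
  \<open>p i\<close> along \<open>w\<close>. The recursion on functions avoids sums over words and
  has the shape of \<open>cut_bound_step\<close>.\<close>

primrec level :: "(nat \<Rightarrow> real) \<Rightarrow> 'a measure \<Rightarrow> nat \<Rightarrow> ('a \<Rightarrow> ennreal) \<Rightarrow> ennreal" where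
  "level p P 0 g = nn_integral P g"
| "level p P (Suc k) g = (\<Sum>i=1..N. ennreal (p i) * level p P k (\<lambda>y. g (f i y)))"

text \<open>Each of the \<open>k\<close> letters may reduce the budget by a factor as small as
  \<open>m\<close>, and what reaches \<open>P\<close> must still be at least \<open>m\<close>; hence
  the condition on \<open>x * m ^ k\<close>. The constant \<open>c\<close> does not depend on
  \<open>k\<close>.\<close>

lemma cut_bound_level:
  assumes P: "\<And>x. m \<le> x \<Longrightarrow> cut_bound P r c \<theta> x (nn_integral P)"
    and b: "\<And>i. i \<in> {1..N} \<Longrightarrow> m \<le> b i"
      "\<And>i. i \<in> {1..N} \<Longrightarrow> b i powr \<theta> = p i * s i powr r" "1 \<le> (\<Sum>i=1..N. b i)"
    and m: "0 < m" and p: "\<And>i. i \<in> {1..N} \<Longrightarrow> 0 \<le> p i"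
    and x: "m \<le> x * m ^ k"
  shows "cut_bound P r c \<theta> x (level p P k)"
  using x
proof (induction k arbitrary: x)
  case 0
  have "level p P 0 = nn_integral P" by (rule ext) simp
  with 0 P show ?case by simp
next
  case (Suc k)
  have "0 < x * m ^ Suc k" using Suc.prems m by linarith
  then have x: "0 < x" by (rule zero_less_mult_pos2) (use m in simp)
  have "cut_bound P r c \<theta> (x * b i) (level p P k)" if i: "i \<in> {1..N}" for i
  proof (rule Suc.IH)
    have "x * m ^ k * m \<le> x * m ^ k * b i" using x m b(1)[OF i] by (intro mult_left_mono) auto
    then show "m \<le> x * b i * m ^ k" using Suc.prems by (simp add: mult_ac)
  qed
  moreover have "0 < b i" if "i \<in> {1..N}" for i using b(1)[OF that] m(1) by simp
  moreover have "level p P (Suc k) = (\<lambda>g. \<Sum>i=1..N. ennreal (p i) * level p P k (\<lambda>y. g (f i y)))"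
    by (rule ext) simp
  ultimately show ?case
    using x b p by (simp only:) (intro cut_bound_step[where b=b], auto)
qed

text \<open>Substituting the bound for \<open>L\<close> levels into the equation of
  \<open>\<mu>\<close> shifts every level by one, and the term with \<open>\<nu>\<close> supplies
  level 0.\<close>

lemma level_sum_le:
  assumes \<mu>: "inhomogeneous_self_similar_measure N f p \<nu> \<mu>" "sets \<nu> = sets borel"
    and g: "g \<in> borel_measurable borel"
  shows "(\<Sum>k<L. ennreal (p 0) * level p \<nu> k g) \<le> (\<integral>\<^sup>+x. g x \<partial>\<mu>)"
  using g
proof (induction L arbitrary: g)
  case (Suc L)
  have "(\<Sum>k<L. \<Sum>i=1..N. ennreal (p i) * (ennreal (p 0) * level p \<nu> k (\<lambda>y. g (f i y))))
    = (\<Sum>i=1..N. ennreal (p i) * (\<Sum>k<L. ennreal (p 0) * level p \<nu> k (\<lambda>y. g (f i y))))"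
    by (subst sum.swap) (simp add: sum_distrib_left)
  also have "\<dots> \<le> (\<Sum>i=1..N. ennreal (p i) * (\<integral>\<^sup>+x. g (f i x) \<partial>\<mu>))"
  proof (intro sum_mono mult_left_mono)
    fix i assume i: "i \<in> {1..N}"
    have "(\<lambda>y. g (f i y)) \<in> borel_measurable borel"
      using measurable_compose[OF measurable_f[OF i] Suc.prems] .
    then show "(\<Sum>k<L. ennreal (p 0) * level p \<nu> k (\<lambda>y. g (f i y))) \<le> (\<integral>\<^sup>+x. g (f i x) \<partial>\<mu>)"
      by (rule Suc.IH)
  qed simp
  finally have le: "(\<Sum>k<L. \<Sum>i=1..N. ennreal (p i) * (ennreal (p 0) * level p \<nu> k (\<lambda>y. g (f i y))))
    \<le> (\<Sum>i=1..N. ennreal (p i) * (\<integral>\<^sup>+x. g (f i x) \<partial>\<mu>))" .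
  have "(\<Sum>k<Suc L. ennreal (p 0) * level p \<nu> k g) = ennreal (p 0) * (\<integral>\<^sup>+x. g x \<partial>\<nu>)
    + (\<Sum>k<L. \<Sum>i=1..N. ennreal (p i) * (ennreal (p 0) * level p \<nu> k (\<lambda>y. g (f i y))))"
    unfolding sum.lessThan_Suc_shift by (simp add: sum_distrib_left mult_ac)
  then show ?case
    unfolding inhomogeneous_nn_integral[OF \<mu> Suc.prems] by (simp only: add_left_mono[OF le])
qed simp

text \<open>The cut gives every word the same lower bound for its contribution, so it does not
  matter which words are spoilt by \<open>\<alpha>\<close>. On the images of \<open>V\<close> under
  the others the distance to \<open>\<alpha>\<close> is at least
  \<open>\<delta> * ratio w\<close>.\<close>

lemma cut_bound_packing:
  assumes cut: "cut_bound P r c \<theta> (2 * real n) \<Phi>"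
    and V: "V \<in> sets P" "\<delta> > 0"
    and sep: "\<And>u v x y. u \<in> words \<Longrightarrow> v \<in> words \<Longrightarrow> u \<parallel> v \<Longrightarrow> x \<in> V \<Longrightarrow> y \<in> V \<Longrightarrow>
      \<delta> * (ratio u + ratio v) \<le> dist (wmap u x) (wmap v y)"
    and \<alpha>: "finite \<alpha>" "\<alpha> \<noteq> {}" "card \<alpha> \<le> n" and c: "c \<ge> 0" "r > 0"
  shows "ennreal (real n * (c * (2 * real n) powr (-\<theta>) * \<delta> powr r)) * emeasure P V
    \<le> \<Phi> (\<lambda>x. ennreal (infdist x \<alpha> powr r))"
proof -
  obtain A q where Aq: "weighted_cut P r c \<theta> (2 * real n) \<Phi> A q"
    using cut unfolding cut_bound_def by blast
  note A = weighted_cutD[OF Aq]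
  define bad where "bad = {w\<in>A. \<exists>a\<in>\<alpha>. \<exists>x\<in>V. dist (wmap w x) a < \<delta> * ratio w}"
  have bad: "bad \<subseteq> A" by (auto simp: bad_def)
  have "card bad \<le> n"
  proof -
    have "\<forall>w\<in>bad. \<exists>a\<in>\<alpha>. \<exists>x\<in>V. dist (wmap w x) a < \<delta> * ratio w" by (auto simp: bad_def)
    then obtain a x where ax: "\<And>w. w \<in> bad \<Longrightarrow> a w \<in> \<alpha>" "\<And>w. w \<in> bad \<Longrightarrow> x w \<in> V"
      "\<And>w. w \<in> bad \<Longrightarrow> dist (wmap w (x w)) (a w) < \<delta> * ratio w" by metis
    have "inj_on a bad"
    proof (rule inj_onI, rule ccontr)
      fix u v assume h: "u \<in> bad" "v \<in> bad" "a u = a v" "u \<noteq> v"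
      \<comment> \<open>A shared quantizer point would bring two images of \<open>V\<close> closer
        than the separation allows.\<close>
      have "dist (wmap u (x u)) (wmap v (x v)) < \<delta> * ratio u + \<delta> * ratio v"
        using ax(3)[OF h(1)] ax(3)[OF h(2)] h(3) dist_triangle2[of "wmap u (x u)" "wmap v (x v)" "a u"] by simp
      moreover have "u \<in> words" "v \<in> words" "u \<parallel> v" using h A(2,3) bad by auto
      ultimately show False using sep[of u v "x u" "x v"] ax(2) h by (simp add: distrib_left)
    qed
    then have "card bad \<le> card \<alpha>" using ax(1) \<alpha>(1) by (intro card_inj_on_le[of a]) auto
    with \<alpha>(3) show ?thesis by simp
  qed
  then have good: "n \<le> card (A - bad)"
    using A(1,4) bad by (simp add: card_Diff_subset finite_subset)
  define \<kappa> where "\<kappa> = c * (2 * real n) powr (-\<theta>) * \<delta> powr r"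
  have \<kappa>: "\<kappa> \<ge> 0" unfolding \<kappa>_def using c by simp
  have each: "ennreal \<kappa> * emeasure P V
      \<le> ennreal (q w) * (\<integral>\<^sup>+y. ennreal (infdist (wmap w y) \<alpha> powr r) \<partial>P)" if w: "w \<in> A - bad" for w
  proof -
    have rw: "ratio w > 0" using w A(2) ratio_pos by auto
    have "\<kappa> \<le> (q w * ratio w powr r) * \<delta> powr r"
      unfolding \<kappa>_def using A(6) w by (intro mult_right_mono) auto
    also have "\<dots> = q w * (\<delta> * ratio w) powr r" using rw V(2) by (simp add: powr_mult)
    finally have "ennreal \<kappa> * emeasure P V \<le> ennreal (q w * (\<delta> * ratio w) powr r) * emeasure P V"
      by (intro mult_right_mono ennreal_leI) auto
    also have "\<dots> = ennreal (q w) * (\<integral>\<^sup>+y. ennreal ((\<delta> * ratio w) powr r) * indicator V y \<partial>P)"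
      using V(1) A(5) w by (simp add: nn_integral_cmult_indicator ennreal_mult mult.assoc)
    also have "\<dots> \<le> ennreal (q w) * (\<integral>\<^sup>+y. ennreal (infdist (wmap w y) \<alpha> powr r) \<partial>P)"
    proof (intro mult_left_mono nn_integral_mono)
      fix y
      have "\<delta> * ratio w \<le> infdist (wmap w y) \<alpha>" if "y \<in> V"
        unfolding infdist_notempty[OF \<alpha>(2)] using w that \<alpha>(2)
        by (intro cINF_greatest) (auto simp: bad_def not_less)
      then show "ennreal ((\<delta> * ratio w) powr r) * indicator V y \<le> ennreal (infdist (wmap w y) \<alpha> powr r)"
        using rw V(2) c(2) by (auto split: split_indicator intro!: ennreal_leI powr_mono2)
    qed simp
    finally show ?thesis .
  qed
  have "ennreal (real n * \<kappa>) * emeasure P V = of_nat n * (ennreal \<kappa> * emeasure P V)"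
    using \<kappa> by (simp add: ennreal_mult ennreal_of_nat_eq_real_of_nat mult.assoc)
  also have "\<dots> \<le> of_nat (card (A - bad)) * (ennreal \<kappa> * emeasure P V)"
    using good by (intro mult_right_mono) auto
  also have "\<dots> = (\<Sum>w\<in>A - bad. ennreal \<kappa> * emeasure P V)" by simp
  also have "\<dots> \<le> (\<Sum>w\<in>A - bad. ennreal (q w) * (\<integral>\<^sup>+y. ennreal (infdist (wmap w y) \<alpha> powr r) \<partial>P))"
    using each by (rule sum_mono)
  also have "\<dots> \<le> (\<Sum>w\<in>A. ennreal (q w) * (\<integral>\<^sup>+y. ennreal (infdist (wmap w y) \<alpha> powr r) \<partial>P))"
    using A(1) by (intro sum_mono2) auto
  also have "\<dots> \<le> \<Phi> (\<lambda>x. ennreal (infdist x \<alpha> powr r))"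
    by (rule A(7)[OF infdist_powr_measurable])
  finally show ?thesis by (simp add: \<kappa>_def)
qed

end

section \<open>Upper bounds\<close>

text \<open>The start of the recursion for the upper bounds: quantization by the origin
  alone.\<close>

lemma moment_bound:
  assumes P: "prob_space P" "sets P = sets borel"
    and R: "emeasure P {x::'a::euclidean_space. norm x > R} = 0" "0 \<le> R" "0 < r"
  shows "(\<integral>\<^sup>+x. ennreal (infdist x {0} powr r) \<partial>P) \<le> ennreal (R powr r)"
proof -
  interpret prob_space P by fact
  have "{x::'a. norm x > R} \<in> sets P"
    unfolding P(2) by (intro borel_open open_Collect_less continuous_intros)
  then have "AE x in P. \<not> norm x > R"
    using R(1) sets_eq_imp_space_eq[OF P(2)] by (intro AE_I[of _ _ "{x. norm x > R}"]) auto
  then have "(\<integral>\<^sup>+x. ennreal (infdist x {0} powr r) \<partial>P) \<le> (\<integral>\<^sup>+x. ennreal (R powr r) \<partial>P)"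
    using R(3) by (intro nn_integral_mono_AE) (auto intro!: ennreal_leI powr_mono2)
  also have "\<dots> = ennreal (R powr r)" using emeasure_space_1 by simp
  finally show ?thesis .
qed

text \<open>With \<open>\<rho> = r / u\<close>, taking the root of order \<open>r\<close> gives an
  error of order \<open>n powr (-(1 / u))\<close>. A single \<open>K\<close> bounds both the points
  and the integral because the same inequality closes the recursion for both.\<close>

definition quantizable :: "'a::metric_space measure \<Rightarrow> real \<Rightarrow> real \<Rightarrow> real \<Rightarrow> bool" where
  "quantizable P r \<rho> K \<longleftrightarrow> (\<forall>x\<ge>1. \<exists>\<alpha>. finite \<alpha> \<and> \<alpha> \<noteq> {} \<and> real (card \<alpha>) \<le> K * x \<and>
     (\<integral>\<^sup>+y. ennreal (infdist y \<alpha> powr r) \<partial>P) \<le> ennreal (K * x powr (-\<rho>)))"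

context similitude_system
begin

lemma infdist_image_le:
  assumes "i \<in> {1..N}" "\<alpha> \<noteq> {}" "finite \<alpha>" "f i ` \<alpha> \<subseteq> \<beta>"
  shows "infdist (f i y) \<beta> \<le> s i * infdist y \<alpha>"
proof -
  obtain a where a: "a \<in> \<alpha>" "infdist y \<alpha> = dist y a"
    using infdist_attains_inf[of \<alpha> y] assms by (auto intro: finite_imp_closed)
  then have "f i a \<in> \<beta>" using assms by auto
  then have "infdist (f i y) \<beta> \<le> dist (f i y) (f i a)" by (rule infdist_le)
  then show ?thesis using a dist_f[OF assms(1)] by simp
qed

text \<open>\<open>Z\<close> is the inhomogeneous part: zero for \<open>\<nu>\<close>, and
  \<open>p 0\<close> times integration against \<open>\<nu>\<close> for \<open>\<mu>\<close>. Its
  points \<open>\<alpha>0\<close> are merged with the images of the recursive quantizers, so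
  \<open>Z\<close> has to be controlled for every finite superset. Points and error both come down
  to \<open>L + K * \<gamma> \<le> K\<close>.\<close>

lemma quantizer_recursion:
  assumes P: "\<And>g. g \<in> borel_measurable borel \<Longrightarrow>
      nn_integral P g \<le> Z g + (\<Sum>i=1..N. ennreal (q i) * (\<integral>\<^sup>+x. g (f i x) \<partial>P))"
    "sets P = sets borel"
    and Z: "\<And>x. 1 < x \<Longrightarrow> \<exists>\<alpha>0. finite \<alpha>0 \<and> real (card \<alpha>0) \<le> L * x \<and>
      (\<forall>\<alpha>. finite \<alpha> \<longrightarrow> \<alpha> \<noteq> {} \<longrightarrow> \<alpha>0 \<subseteq> \<alpha> \<longrightarrow>
        Z (\<lambda>y. ennreal (infdist y \<alpha> powr r)) \<le> ennreal (L * x powr (-\<rho>)))"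
    and b: "\<And>i. i \<in> {1..N} \<Longrightarrow> m \<le> b i" "\<And>i. i \<in> {1..N} \<Longrightarrow> b i \<le> \<beta>"
      "\<And>i. i \<in> {1..N} \<Longrightarrow> b i powr (1 + \<rho>) = q i * s i powr r" "(\<Sum>i=1..N. b i) \<le> \<gamma>"
    and m: "0 < m" "0 < \<beta>" "\<beta> < 1" and q: "\<And>i. i \<in> {1..N} \<Longrightarrow> 0 \<le> q i"
    and N: "N \<ge> 1" and r: "r > 0" "\<rho> > 0"
    and K: "0 \<le> L" "0 \<le> K" "L + K * \<gamma> \<le> K" "1 \<le> K * m"
      "(\<integral>\<^sup>+y. ennreal (infdist y {0} powr r) \<partial>P) \<le> ennreal K"
    and x: "m \<le> x"
  shows "\<exists>\<alpha>. finite \<alpha> \<and> \<alpha> \<noteq> {} \<and> real (card \<alpha>) \<le> K * x \<and>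
     (\<integral>\<^sup>+y. ennreal (infdist y \<alpha> powr r) \<partial>P) \<le> ennreal (K * x powr (-\<rho>))"
proof (rule scale_induct[OF m(2,3) x])
  fix x assume x: "m \<le> x" "x \<le> 1"
  \<comment> \<open>For \<open>x \<le> 1\<close> the factor \<open>x powr (-\<rho>)\<close> is at
    least 1, so \<open>{0}\<close> meets the error bound; \<open>1 \<le> K * m\<close> pays for its
    single point.\<close>
  have "K * 1 \<le> K * x powr (-\<rho>)"
  proof (intro mult_left_mono K(2))
    have "x powr \<rho> \<le> 1" using x m(1) r(2) by (intro powr_le1) auto
    then show "1 \<le> x powr (-\<rho>)" using x m(1) by (simp add: powr_minus one_le_inverse_iff)
  qed
  then have "ennreal K \<le> ennreal (K * x powr (-\<rho>))" by (intro ennreal_leI) simp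
  moreover have "K * m \<le> K * x" using x K by (intro mult_left_mono) auto
  ultimately show "\<exists>\<alpha>. finite \<alpha> \<and> \<alpha> \<noteq> {} \<and> real (card \<alpha>) \<le> K * x \<and>
     (\<integral>\<^sup>+y. ennreal (infdist y \<alpha> powr r) \<partial>P) \<le> ennreal (K * x powr (-\<rho>))"
    using K(4,5) by (intro exI[of _ "{0}"]) (auto intro: order_trans)
next
  fix x :: real
  let ?Q = "\<lambda>x \<alpha>. finite \<alpha> \<and> \<alpha> \<noteq> {} \<and> real (card \<alpha>) \<le> K * x \<and>
     (\<integral>\<^sup>+y. ennreal (infdist y \<alpha> powr r) \<partial>P) \<le> ennreal (K * x powr (-\<rho>))"
  assume x: "1 < x" and IH: "\<And>y. m \<le> y \<Longrightarrow> y \<le> \<beta> * x \<Longrightarrow> \<exists>\<alpha>. ?Q y \<alpha>"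
  obtain \<alpha>0 where \<alpha>0: "finite \<alpha>0" "real (card \<alpha>0) \<le> L * x"
    "\<And>\<alpha>. finite \<alpha> \<Longrightarrow> \<alpha> \<noteq> {} \<Longrightarrow> \<alpha>0 \<subseteq> \<alpha> \<Longrightarrow>
        Z (\<lambda>y. ennreal (infdist y \<alpha> powr r)) \<le> ennreal (L * x powr (-\<rho>))"
    using Z[OF x] by blast
  have "\<forall>i\<in>{1..N}. \<exists>\<alpha>. ?Q (x * b i) \<alpha>"
  proof
    fix i assume i: "i \<in> {1..N}"
    have "1 * b i \<le> x * b i" using x b(1)[OF i] m(1) by (intro mult_right_mono) auto
    then show "\<exists>\<alpha>. ?Q (x * b i) \<alpha>" using IH b(1,2)[OF i] x by (intro IH) auto
  qed
  then obtain A where "\<forall>i\<in>{1..N}. ?Q (x * b i) (A i)"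
    using bchoice[of "{1..N}" "\<lambda>i \<alpha>. ?Q (x * b i) \<alpha>"] by blast
  then have A: "\<And>i. i \<in> {1..N} \<Longrightarrow> finite (A i)" "\<And>i. i \<in> {1..N} \<Longrightarrow> A i \<noteq> {}"
      "\<And>i. i \<in> {1..N} \<Longrightarrow> real (card (A i)) \<le> K * (x * b i)"
      "\<And>i. i \<in> {1..N} \<Longrightarrow> (\<integral>\<^sup>+y. ennreal (infdist y (A i) powr r) \<partial>P) \<le> ennreal (K * (x * b i) powr (-\<rho>))"
    by simp_all
  define \<alpha> where "\<alpha> = \<alpha>0 \<union> (\<Union>i\<in>{1..N}. f i ` A i)"
  have fin: "finite \<alpha>" unfolding \<alpha>_def using \<alpha>0(1) A(1) by auto
  have ne: "\<alpha> \<noteq> {}" unfolding \<alpha>_def using A(2)[of 1] N by auto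
  have "real (card \<alpha>) \<le> K * x"
  proof -
    have "card \<alpha> \<le> card \<alpha>0 + card (\<Union>i\<in>{1..N}. f i ` A i)"
      unfolding \<alpha>_def by (rule card_Un_le)
    also have "card (\<Union>i\<in>{1..N}. f i ` A i) \<le> (\<Sum>i=1..N. card (f i ` A i))"
      by (rule card_UN_le) simp
    also have "\<dots> \<le> (\<Sum>i=1..N. card (A i))" using A(1) by (intro sum_mono card_image_le) auto
    finally have "real (card \<alpha>) \<le> real (card \<alpha>0) + (\<Sum>i=1..N. real (card (A i)))"
      by (simp flip: of_nat_sum of_nat_add)
    also have "\<dots> \<le> L * x + (\<Sum>i=1..N. K * (x * b i))"
      using \<alpha>0(2) A(3) by (intro add_mono sum_mono) auto
    also have "\<dots> = (L + K * (\<Sum>i=1..N. b i)) * x"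
      by (simp add: sum_distrib_left sum_distrib_right algebra_simps)
    also have "\<dots> \<le> (L + K * \<gamma>) * x"
      using x b(4) K(2) by (intro mult_right_mono add_left_mono mult_left_mono) auto
    also have "\<dots> \<le> K * x" using x K(3) by (intro mult_right_mono) auto
    finally show ?thesis .
  qed
  moreover have "(\<integral>\<^sup>+y. ennreal (infdist y \<alpha> powr r) \<partial>P) \<le> ennreal (K * x powr (-\<rho>))"
  proof -
    have each: "ennreal (q i) * (\<integral>\<^sup>+y. ennreal (infdist (f i y) \<alpha> powr r) \<partial>P) \<le> ennreal (K * x powr (-\<rho>) * b i)"
      if i: "i \<in> {1..N}" for i
    proof -
      have bi: "0 < b i" using b(1)[OF i] m(1) by simp
      have "(\<integral>\<^sup>+y. ennreal (infdist (f i y) \<alpha> powr r) \<partial>P)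
        \<le> (\<integral>\<^sup>+y. ennreal (s i powr r) * ennreal (infdist y (A i) powr r) \<partial>P)"
      proof (rule nn_integral_mono)
        fix y
        have "infdist (f i y) \<alpha> \<le> s i * infdist y (A i)"
          by (rule infdist_image_le[OF i A(2)[OF i] A(1)[OF i]]) (use i in \<open>auto simp: \<alpha>_def\<close>)
        then have "infdist (f i y) \<alpha> powr r \<le> (s i * infdist y (A i)) powr r"
          using r(1) by (intro powr_mono2) (auto simp: infdist_nonneg)
        also have "\<dots> = s i powr r * infdist y (A i) powr r"
          using s_pos[OF i] by (simp add: powr_mult infdist_nonneg)
        finally show "ennreal (infdist (f i y) \<alpha> powr r) \<le> ennreal (s i powr r) * ennreal (infdist y (A i) powr r)"
          by (simp add: ennreal_mult[symmetric])
      qed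
      also have "\<dots> = ennreal (s i powr r) * (\<integral>\<^sup>+y. ennreal (infdist y (A i) powr r) \<partial>P)"
        using measurable_cong_sets[OF P(2) refl, of borel] infdist_powr_measurable
        by (intro nn_integral_cmult) blast
      also have "\<dots> \<le> ennreal (s i powr r) * ennreal (K * (x * b i) powr (-\<rho>))"
        using A(4)[OF i] by (intro mult_left_mono) auto
      finally have "ennreal (q i) * (\<integral>\<^sup>+y. ennreal (infdist (f i y) \<alpha> powr r) \<partial>P)
        \<le> ennreal (q i) * (ennreal (s i powr r) * ennreal (K * (x * b i) powr (-\<rho>)))"
        by (intro mult_left_mono) auto
      also have "\<dots> = ennreal ((q i * s i powr r) * (K * (x * b i) powr (-\<rho>)))"
        using q[OF i] K(2) by (simp add: ennreal_mult mult.assoc)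
      also have "(q i * s i powr r) * (K * (x * b i) powr (-\<rho>)) = K * x powr (-\<rho>) * (b i powr (1 + \<rho>) * b i powr (-\<rho>))"
        using x bi by (simp add: b(3)[OF i] powr_mult mult_ac)
      \<comment> \<open>The share of a piece in the error thus equals its share of the points; the
        exponent \<open>1 + \<rho>\<close> is made for this.\<close>
      also have "b i powr (1 + \<rho>) * b i powr (-\<rho>) = b i"
        using bi by (simp add: powr_add[symmetric])
      finally show ?thesis .
    qed
    have "(\<integral>\<^sup>+y. ennreal (infdist y \<alpha> powr r) \<partial>P) \<le> Z (\<lambda>y. ennreal (infdist y \<alpha> powr r))
      + (\<Sum>i=1..N. ennreal (q i) * (\<integral>\<^sup>+y. ennreal (infdist (f i y) \<alpha> powr r) \<partial>P))"
      using P(1)[OF infdist_powr_measurable] .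
    also have "\<dots> \<le> ennreal (L * x powr (-\<rho>)) + (\<Sum>i=1..N. ennreal (K * x powr (-\<rho>) * b i))"
    proof (intro add_mono sum_mono each)
      show "Z (\<lambda>y. ennreal (infdist y \<alpha> powr r)) \<le> ennreal (L * x powr (-\<rho>))"
        by (rule \<alpha>0(3)[OF fin ne]) (auto simp: \<alpha>_def)
    qed
    also have "\<dots> = ennreal (L * x powr (-\<rho>) + (\<Sum>i=1..N. K * x powr (-\<rho>) * b i))"
    proof -
      have nn: "0 \<le> K * x powr (-\<rho>) * b i" if "i \<in> {1..N}" for i
        using K(2) b(1)[OF that] m(1) by simp
      show ?thesis
        using K(1) nn by (simp add: sum_ennreal sum_nonneg ennreal_plus del: atLeastAtMost_iff)
    qed
    also have "\<dots> \<le> ennreal (K * x powr (-\<rho>))"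
    proof (rule ennreal_leI)
      have "L * x powr (-\<rho>) + (\<Sum>i=1..N. K * x powr (-\<rho>) * b i) = (L + K * (\<Sum>i=1..N. b i)) * x powr (-\<rho>)"
        by (simp add: sum_distrib_left sum_distrib_right algebra_simps)
      also have "\<dots> \<le> (L + K * \<gamma>) * x powr (-\<rho>)"
        using b(4) K(2) by (intro mult_right_mono add_left_mono mult_left_mono) auto
      also have "\<dots> \<le> K * x powr (-\<rho>)" using K(3) by (intro mult_right_mono) auto
      finally show "L * x powr (-\<rho>) + (\<Sum>i=1..N. K * x powr (-\<rho>) * b i) \<le> K * x powr (-\<rho>)" .
    qed
    finally show ?thesis .
  qed
  ultimately show "\<exists>\<alpha>. ?Q x \<alpha>" using fin ne by blast
qed

lemma weight_powr:
  assumes "i \<in> {1..N}" "0 < q" "q \<le> 1" "r > 0" "\<rho> > 0"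
  shows "0 < (q * s i powr r) powr (1 / (1 + \<rho>))" "(q * s i powr r) powr (1 / (1 + \<rho>)) < 1"
    "((q * s i powr r) powr (1 / (1 + \<rho>))) powr (1 + \<rho>) = q * s i powr r"
    "q * s i powr r < 1"
proof -
  have "s i powr r < 1 powr r"
    using s_pos[OF assms(1)] s_less_1[OF assms(1)] assms by (intro powr_less_mono2) auto
  then have l: "s i powr r < 1" by simp
  have "q * s i powr r \<le> 1 * s i powr r" using assms by (intro mult_right_mono) auto
  with l show l': "q * s i powr r < 1" by simp
  have p: "0 < q * s i powr r" using s_pos[OF assms(1)] assms by simp
  then show "0 < (q * s i powr r) powr (1 / (1 + \<rho>))" by (metis less_irrefl powr_gt_zero)
  have "(q * s i powr r) powr (1 / (1 + \<rho>)) < 1 powr (1 / (1 + \<rho>))"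
    using l' p assms by (intro powr_less_mono2) auto
  then show "(q * s i powr r) powr (1 / (1 + \<rho>)) < 1" by simp
  show "((q * s i powr r) powr (1 / (1 + \<rho>))) powr (1 + \<rho>) = q * s i powr r"
    using p assms by (simp add: powr_powr)
qed

lemma finite_bounds:
  fixes b :: "nat \<Rightarrow> real"
  assumes "N \<ge> 1" "\<And>i. i \<in> {1..N} \<Longrightarrow> 0 < b i" "\<And>i. i \<in> {1..N} \<Longrightarrow> b i < 1"
  obtains m \<beta> where "0 < m" "m \<le> \<beta>" "\<beta> < 1" "\<And>i. i \<in> {1..N} \<Longrightarrow> m \<le> b i" "\<And>i. i \<in> {1..N} \<Longrightarrow> b i \<le> \<beta>"
proof (rule that)
  let ?B = "b ` {1..N}"
  have B: "finite ?B" "?B \<noteq> {}" using assms(1) by auto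
  show "0 < Min ?B" "Max ?B < 1" using Min_in[OF B] Max_in[OF B] assms(2,3) by auto
  show "\<And>i. i \<in> {1..N} \<Longrightarrow> Min ?B \<le> b i" "\<And>i. i \<in> {1..N} \<Longrightarrow> b i \<le> Max ?B"
    using B by auto
  show "Min ?B \<le> Max ?B" using B by (meson Max_ge Min_in)
qed

lemma quantizable_self_similar:
  assumes \<nu>: "self_similar_measure N f t \<nu>" and t: "\<And>i. i \<in> {1..N} \<Longrightarrow> 0 < t i \<and> t i \<le> 1" and N: "N \<ge> 1"
    and R: "emeasure \<nu> {x. norm x > R} = 0" "0 \<le> R" and r: "r > 0" "\<rho> > 0"
    and sum: "(\<Sum>i=1..N. (t i * s i powr r) powr (1 / (1 + \<rho>))) \<le> 1"
  shows "\<exists>K\<ge>0. quantizable \<nu> r \<rho> K"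
proof -
  define b where "b i = (t i * s i powr r) powr (1 / (1 + \<rho>))" for i
  have b: "0 < b i" "b i < 1" "b i powr (1 + \<rho>) = t i * s i powr r" if "i \<in> {1..N}" for i
    using weight_powr[OF that _ _ r, of "t i"] t[OF that] by (auto simp: b_def)
  obtain m \<beta> where m: "0 < m" "m \<le> \<beta>" "\<beta> < 1" "\<And>i. i \<in> {1..N} \<Longrightarrow> m \<le> b i" "\<And>i. i \<in> {1..N} \<Longrightarrow> b i \<le> \<beta>"
    using finite_bounds[OF N, of b] b(1,2) by metis
  \<comment> \<open>\<open>1 / m\<close> pays for one point at \<open>x = m\<close>, and
    \<open>R powr r\<close> bounds the error of the origin.\<close>
  define K where "K = max (1 / m) (R powr r)"
  have K: "K \<ge> 0" "1 \<le> K * m" "R powr r \<le> K"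
    using m(1) by (auto simp: K_def max_def field_simps)
  have P: "prob_space \<nu>" "sets \<nu> = sets borel"
    using \<nu> by (auto simp: self_similar_measure_def borel_probability_measure_def)
  have "quantizable \<nu> r \<rho> K"
    unfolding quantizable_def
  proof (intro allI impI)
    fix x :: real assume x: "1 \<le> x"
    show "\<exists>\<alpha>. finite \<alpha> \<and> \<alpha> \<noteq> {} \<and> real (card \<alpha>) \<le> K * x \<and>
     (\<integral>\<^sup>+y. ennreal (infdist y \<alpha> powr r) \<partial>\<nu>) \<le> ennreal (K * x powr (-\<rho>))"
    proof (rule quantizer_recursion[where Z="\<lambda>_. 0" and q=t and L=0 and b=b and \<beta>=\<beta> and \<gamma>=1 and m=m])
      show "nn_integral \<nu> g \<le> 0 + (\<Sum>i=1..N. ennreal (t i) * (\<integral>\<^sup>+x. g (f i x) \<partial>\<nu>))"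
        if "g \<in> borel_measurable borel" for g
        using self_similar_nn_integral[OF \<nu> that] by simp
      show "\<exists>\<alpha>0::'a set. finite \<alpha>0 \<and> real (card \<alpha>0) \<le> 0 * x \<and> (\<forall>\<alpha>. finite \<alpha> \<longrightarrow> \<alpha> \<noteq> {} \<longrightarrow> \<alpha>0 \<subseteq> \<alpha> \<longrightarrow>
        0 \<le> ennreal (0 * x powr (-\<rho>)))" for x :: real
        by (intro exI[of _ "{}"]) simp
      show "(\<integral>\<^sup>+y. ennreal (infdist y {0} powr r) \<partial>\<nu>) \<le> ennreal K"
        using moment_bound[OF P R r(1)] K(3) ennreal_leI order_trans by blast
      show "m \<le> x" using x m(1-3) by simp
    qed (use b m K N r t sum P(2) in \<open>auto simp: b_def[symmetric] less_imp_le\<close>)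
  qed
  with K show ?thesis by blast
qed

lemma quantizable_inhomogeneous:
  assumes \<mu>: "inhomogeneous_self_similar_measure N f p \<nu> \<mu>" and \<nu>: "sets \<nu> = sets borel"
    and p: "\<And>i. i \<in> {0..N} \<Longrightarrow> 0 < p i \<and> p i \<le> 1" and N: "N \<ge> 1"
    and R: "emeasure \<mu> {x. norm x > R} = 0" "0 \<le> R" and r: "r > 0" "\<rho> > 0"
    and sum: "(\<Sum>i=1..N. (p i * s i powr r) powr (1 / (1 + \<rho>))) < 1"
    and K0: "K0 \<ge> 0" "quantizable \<nu> r \<rho> K0"
  shows "\<exists>K\<ge>0. quantizable \<mu> r \<rho> K"
proof -
  define b where "b i = (p i * s i powr r) powr (1 / (1 + \<rho>))" for i
  have b: "0 < b i" "b i < 1" "b i powr (1 + \<rho>) = p i * s i powr r" if "i \<in> {1..N}" for i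
    using weight_powr[OF that _ _ r, of "p i"] p[of i] that by (auto simp: b_def)
  obtain m \<beta> where m: "0 < m" "m \<le> \<beta>" "\<beta> < 1" "\<And>i. i \<in> {1..N} \<Longrightarrow> m \<le> b i" "\<And>i. i \<in> {1..N} \<Longrightarrow> b i \<le> \<beta>"
    using finite_bounds[OF N, of b] b(1,2) by metis
  define \<gamma> where "\<gamma> = (\<Sum>i=1..N. b i)"
  have \<gamma>: "\<gamma> < 1" using sum by (simp add: \<gamma>_def b_def)
  \<comment> \<open>The entry \<open>K0 / (1 - \<gamma>)\<close> is the solution of
    \<open>K0 + K * \<gamma> = K\<close>; this is where the sum has to be strictly below 1.\<close>
  define K where "K = max (K0 / (1 - \<gamma>)) (max (1 / m) (R powr r))"
  have K: "K \<ge> 0" "1 \<le> K * m" "R powr r \<le> K" "K0 / (1 - \<gamma>) \<le> K"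
  proof -
    have "1 / m \<le> K" by (simp add: K_def)
    then show "1 \<le> K * m" using m(1) by (simp add: field_simps)
    show "K \<ge> 0" using \<open>1 / m \<le> K\<close> m(1) by (smt (verit) divide_nonneg_pos)
    show "R powr r \<le> K" "K0 / (1 - \<gamma>) \<le> K" by (simp_all add: K_def)
  qed
  then have K': "K0 + K * \<gamma> \<le> K" using \<gamma> by (simp add: field_simps)
  have P: "prob_space \<mu>" "sets \<mu> = sets borel"
    using \<mu> by (auto simp: inhomogeneous_self_similar_measure_def borel_probability_measure_def)
  have "quantizable \<mu> r \<rho> K"
    unfolding quantizable_def
  proof (intro allI impI)
    fix x :: real assume x: "1 \<le> x"
    show "\<exists>\<alpha>. finite \<alpha> \<and> \<alpha> \<noteq> {} \<and> real (card \<alpha>) \<le> K * x \<and>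
     (\<integral>\<^sup>+y. ennreal (infdist y \<alpha> powr r) \<partial>\<mu>) \<le> ennreal (K * x powr (-\<rho>))"
    proof (rule quantizer_recursion[where Z="\<lambda>g. ennreal (p 0) * nn_integral \<nu> g" and q=p and L=K0 and b=b
          and \<beta>=\<beta> and \<gamma>=\<gamma> and m=m])
      show "nn_integral \<mu> g \<le> ennreal (p 0) * nn_integral \<nu> g + (\<Sum>i=1..N. ennreal (p i) * (\<integral>\<^sup>+x. g (f i x) \<partial>\<mu>))"
        if "g \<in> borel_measurable borel" for g
        using inhomogeneous_nn_integral[OF \<mu> \<nu> that] by simp
      show "\<exists>\<alpha>0. finite \<alpha>0 \<and> real (card \<alpha>0) \<le> K0 * x \<and> (\<forall>\<alpha>. finite \<alpha> \<longrightarrow> \<alpha> \<noteq> {} \<longrightarrow> \<alpha>0 \<subseteq> \<alpha> \<longrightarrow>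
        ennreal (p 0) * (\<integral>\<^sup>+y. ennreal (infdist y \<alpha> powr r) \<partial>\<nu>) \<le> ennreal (K0 * x powr (-\<rho>)))"
        if x: "1 < x" for x :: real
      proof -
        obtain \<alpha>0 where \<alpha>0: "finite \<alpha>0" "\<alpha>0 \<noteq> {}" "real (card \<alpha>0) \<le> K0 * x"
          "(\<integral>\<^sup>+y. ennreal (infdist y \<alpha>0 powr r) \<partial>\<nu>) \<le> ennreal (K0 * x powr (-\<rho>))"
          using K0(2) x unfolding quantizable_def by (meson less_imp_le)
        \<comment> \<open>Distances only decrease when points are added, and
          \<open>p 0 \<le> 1\<close>.\<close>
        have "ennreal (p 0) * (\<integral>\<^sup>+y. ennreal (infdist y \<alpha> powr r) \<partial>\<nu>) \<le> ennreal (K0 * x powr (-\<rho>))"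
          if "\<alpha>0 \<subseteq> \<alpha>" for \<alpha>
        proof -
          have "ennreal (p 0) * (\<integral>\<^sup>+y. ennreal (infdist y \<alpha> powr r) \<partial>\<nu>)
            \<le> 1 * (\<integral>\<^sup>+y. ennreal (infdist y \<alpha>0 powr r) \<partial>\<nu>)"
            using p[of 0] that \<alpha>0(2) r(1)
            by (intro mult_mono nn_integral_mono ennreal_leI powr_mono2 infdist_mono)
              (auto simp: infdist_nonneg)
          with \<alpha>0(4) show ?thesis by simp
        qed
        with \<alpha>0 show ?thesis by blast
      qed
      show "(\<integral>\<^sup>+y. ennreal (infdist y {0} powr r) \<partial>\<mu>) \<le> ennreal K"
        using moment_bound[OF P R r(1)] K(3) ennreal_leI order_trans by blast
      show "m \<le> x" using x m(1-3) by simp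
    qed (use b m K K' K0 N r p P(2) in \<open>auto simp: \<gamma>_def less_imp_le\<close>)
  qed
  with K show ?thesis by blast
qed

text \<open>The order of quantifiers is the point: \<open>\<kappa>\<close> is chosen before
  \<open>n\<close> and \<open>\<Phi>\<close>, so one constant serves all levels, and their number
  can later be multiplied in.\<close>

lemma cut_bound_error:
  assumes N: "N \<ge> 1" and osc: "open_set_condition N f"
    and inv: "\<And>R i. R0 \<le> R \<Longrightarrow> i \<in> {1..N} \<Longrightarrow> norm (f i 0) + s i * R \<le> R"
    and P: "prob_space P" "sets P = sets borel" "superinvariant q P" "\<And>i. i \<in> {1..N} \<Longrightarrow> q i > 0"
    and supp: "\<And>R. R0 \<le> R \<Longrightarrow> emeasure P {x. norm x > R} = 0"
    and c: "c > 0" "r > 0"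
  shows "\<exists>\<kappa>>0. \<forall>n\<ge>1. \<forall>\<Phi>. cut_bound P r c (1 + \<rho>) (2 * real n) \<Phi> \<longrightarrow>
    (\<forall>\<alpha>. finite \<alpha> \<longrightarrow> \<alpha> \<noteq> {} \<longrightarrow> card \<alpha> \<le> n \<longrightarrow>
      ennreal (\<kappa> * real n powr (-\<rho>)) \<le> \<Phi> (\<lambda>x. ennreal (infdist x \<alpha> powr r)))"
proof -
  interpret prob_space P by fact
  obtain R \<sigma> \<delta> where R: "R \<ge> R0" "R > 0" and \<sigma>: "\<sigma> \<in> words" and \<delta>: "\<delta> > 0"
    and sep: "\<And>u v x y. u \<in> words \<Longrightarrow> v \<in> words \<Longrightarrow> u \<parallel> v \<Longrightarrow> x \<in> wmap \<sigma> ` cball 0 R \<Longrightarrow>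
      y \<in> wmap \<sigma> ` cball 0 R \<Longrightarrow> \<delta> * (ratio u + ratio v) \<le> dist (wmap u x) (wmap v y)"
    using strong_separation[OF N osc cball_invariantI[OF inv]] by metis
  define V where "V = wmap \<sigma> ` cball (0::'a) R"
  have sp: "space P = UNIV" using sets_eq_imp_space_eq[OF P(2)] by simp
  have "emeasure P (cball 0 R) = 1"
  proof -
    have S: "{x::'a. norm x > R} \<in> sets P"
      unfolding P(2) by (intro borel_open open_Collect_less continuous_intros)
    have "emeasure P (UNIV - {x. norm x > R}) = 1 - 0"
      using emeasure_compl[OF S] supp[OF R(1)] emeasure_space_1 by (simp add: sp)
    moreover have "UNIV - {x. norm x > R} = cball (0::'a) R" by auto
    ultimately show ?thesis by simp
  qed
  then have V: "emeasure P V > 0" unfolding V_def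
    using superinvariant_wmap_pos[OF P(3,2,4) compact_cball _ \<sigma>] by simp
  have Vm: "V \<in> sets P"
    unfolding V_def P(2) using continuous_wmap[OF \<sigma>]
    by (intro borel_compact compact_continuous_image) (auto intro: continuous_on_subset)
  define \<kappa> where "\<kappa> = c * 2 powr (-(1 + \<rho>)) * \<delta> powr r * measure P V"
  have mV: "measure P V > 0" using V by (simp add: emeasure_eq_measure)
  have "\<kappa> > 0" unfolding \<kappa>_def using c \<delta> mV by simp
  moreover have "ennreal (\<kappa> * real n powr (-\<rho>)) \<le> \<Phi> (\<lambda>x. ennreal (infdist x \<alpha> powr r))"
    if n: "n \<ge> 1" "cut_bound P r c (1 + \<rho>) (2 * real n) \<Phi>" "finite \<alpha>" "\<alpha> \<noteq> {}" "card \<alpha> \<le> n" for n \<Phi> \<alpha>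
  proof -
    \<comment> \<open>The \<open>n\<close> badly approximated pieces, each with an error of order
      \<open>n powr (-(1 + \<rho>))\<close>, add up to the rate
      \<open>n powr (-\<rho>)\<close>.\<close>
    have "real n * real n powr (-(1 + \<rho>)) = real n powr (-\<rho>)"
      using n(1) by (simp add: powr_mult_base)
    then have "\<kappa> * real n powr (-\<rho>) = real n * (c * (2 * real n) powr (-(1 + \<rho>)) * \<delta> powr r) * measure P V"
      by (simp add: \<kappa>_def powr_mult mult_ac)
    then have "ennreal (\<kappa> * real n powr (-\<rho>))
      = ennreal (real n * (c * (2 * real n) powr (-(1 + \<rho>)) * \<delta> powr r)) * emeasure P V"
      using c by (simp add: emeasure_eq_measure ennreal_mult'')
    also have "\<dots> \<le> \<Phi> (\<lambda>x. ennreal (infdist x \<alpha> powr r))"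
      using cut_bound_packing[OF n(2) Vm \<delta> _ n(3-5)] sep c unfolding V_def by simp
    finally show ?thesis .
  qed
  ultimately show ?thesis by blast
qed

end

section \<open>Quantization errors, coefficients and dimensions\<close>

lemma ennreal_powr_ennreal: "0 \<le> x \<Longrightarrow> ennreal_powr (ennreal x) a = ennreal (x powr a)"
  by (simp add: ennreal_powr_def)

lemma ennreal_powr_mono:
  assumes "x \<le> y" "0 \<le> a"
  shows "ennreal_powr x a \<le> ennreal_powr y a"
proof (cases "y = \<infinity>")
  case False
  then have "y < top" by (simp add: less_top)
  moreover have "x < top" using assms(1) \<open>y < top\<close> by (rule le_less_trans)
  ultimately show ?thesis using assms
    by (auto simp: ennreal_powr_def intro!: ennreal_leI powr_mono2 enn2real_mono)
qed (simp add: ennreal_powr_def)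

lemma quantization_error_ge:
  assumes "\<And>\<alpha>. finite \<alpha> \<Longrightarrow> \<alpha> \<noteq> {} \<Longrightarrow> card \<alpha> \<le> n \<Longrightarrow>
      ennreal C \<le> (\<integral>\<^sup>+x. ennreal (infdist x \<alpha> powr r) \<partial>P)" "0 \<le> C" "r > 0"
  shows "ennreal (C powr (1 / r)) \<le> quantization_error n r P"
  unfolding quantization_error_def
proof (rule INF_greatest)
  fix \<alpha> :: "'a set" assume "\<alpha> \<in> {\<alpha>. 1 \<le> card \<alpha> \<and> card \<alpha> \<le> n}"
  then have "finite \<alpha>" "\<alpha> \<noteq> {}" "card \<alpha> \<le> n" by (auto intro: card_ge_0_finite)
  then show "ennreal (C powr (1 / r)) \<le> ennreal_powr (\<integral>\<^sup>+x. ennreal (infdist x \<alpha> powr r) \<partial>P) (1 / r)"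
    using ennreal_powr_mono[OF assms(1), of \<alpha> "1 / r"] assms(2,3) by (simp add: ennreal_powr_ennreal)
qed

lemma quantization_error_le:
  assumes "finite \<alpha>" "\<alpha> \<noteq> {}" "card \<alpha> \<le> n" "(\<integral>\<^sup>+x. ennreal (infdist x \<alpha> powr r) \<partial>P) \<le> ennreal C"
    "0 \<le> C" "r > 0"
  shows "quantization_error n r P \<le> ennreal (C powr (1 / r))"
proof -
  have "\<alpha> \<in> {\<alpha>. 1 \<le> card \<alpha> \<and> card \<alpha> \<le> n}" using assms(1-3) by (simp add: Suc_le_eq card_gt_0_iff)
  then have "quantization_error n r P \<le> ennreal_powr (\<integral>\<^sup>+x. ennreal (infdist x \<alpha> powr r) \<partial>P) (1 / r)"
    unfolding quantization_error_def by (rule INF_lower)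
  also have "\<dots> \<le> ennreal_powr (ennreal C) (1 / r)"
    using assms(4,6) by (intro ennreal_powr_mono) auto
  finally show ?thesis using assms(5) by (simp add: ennreal_powr_ennreal)
qed

lemma powr_rate:
  assumes "0 \<le> (C::real)" "r > 0" "u > 0" "n \<ge> 1"
  shows "(C * real n powr (-(r / u))) powr (1 / r) = C powr (1 / r) * real n powr (-(1 / u))"
  using assms by (simp add: powr_mult powr_powr)

lemma quantization_error_lower_rate:
  assumes "\<And>\<alpha>. finite \<alpha> \<Longrightarrow> \<alpha> \<noteq> {} \<Longrightarrow> card \<alpha> \<le> n \<Longrightarrow>
      ennreal (C * real n powr (-(r / u))) \<le> (\<integral>\<^sup>+x. ennreal (infdist x \<alpha> powr r) \<partial>P)"
    "0 \<le> C" "r > 0" "u > 0" "n \<ge> 1"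
  shows "ennreal (C powr (1 / r) * real n powr (-(1 / u))) \<le> quantization_error n r P"
  using quantization_error_ge[where C="C * real n powr (-(r / u))" and n=n and r=r and P=P] assms powr_rate[of C r u n] by simp

lemma quantizable_upper_rate:
  assumes P: "quantizable P r (r / u) K" "K \<ge> 0" and r: "r > 0" "u > 0"
  shows "\<exists>D>0. \<forall>\<^sub>F n in sequentially. quantization_error n r P \<le> ennreal (D * real n powr (-(1 / u)))"
proof -
  \<comment> \<open>The budget is taken as \<open>x = n / H\<close>, so that \<open>K * x\<close> is
    at most \<open>n\<close>; the 1 keeps the divisor positive, and \<open>E\<close> absorbs the
    loss \<open>H powr (r / u)\<close>.\<close>
  define H where "H = max K 1"
  have H: "H \<ge> 1" "K \<le> H" by (auto simp: H_def)
  define E where "E = H * H powr (r / u)"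
  have E: "E > 0" using H by (simp add: E_def)
  have "quantization_error n r P \<le> ennreal (E powr (1 / r) * real n powr (-(1 / u)))" if n: "n \<ge> nat \<lceil>H\<rceil>" for n
  proof -
    have nH: "real n \<ge> H" using n by linarith
    then have n1: "n \<ge> 1" using H by simp
    have "real n / H \<ge> 1" using nH H by simp
    then obtain \<alpha> where \<alpha>: "finite \<alpha>" "\<alpha> \<noteq> {}" "real (card \<alpha>) \<le> K * (real n / H)"
      "(\<integral>\<^sup>+y. ennreal (infdist y \<alpha> powr r) \<partial>P) \<le> ennreal (K * (real n / H) powr (-(r / u)))"
      using P(1) unfolding quantizable_def by blast
    have "K * (real n / H) \<le> H * (real n / H)" using H by (intro mult_right_mono) auto
    then have c: "card \<alpha> \<le> n" using \<alpha>(3) H by simp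
    have "K * (real n / H) powr (-(r / u)) \<le> H * (real n / H) powr (-(r / u))"
      using H by (intro mult_right_mono) auto
    also have "\<dots> = E * real n powr (-(r / u))"
      using H by (simp add: E_def powr_divide powr_minus field_simps)
    finally have "(\<integral>\<^sup>+y. ennreal (infdist y \<alpha> powr r) \<partial>P) \<le> ennreal (E * real n powr (-(r / u)))"
      using \<alpha>(4) by (meson ennreal_leI order_trans)
    then have "quantization_error n r P \<le> ennreal ((E * real n powr (-(r / u))) powr (1 / r))"
      using \<alpha> c E r by (intro quantization_error_le) auto
    then show ?thesis using powr_rate[of E r u n] E r n1 by simp
  qed
  then have "\<forall>\<^sub>F n in sequentially. quantization_error n r P \<le> ennreal (E powr (1 / r) * real n powr (-(1 / u)))"
    by (rule eventually_sequentiallyI)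
  then show ?thesis using E by (intro exI[of _ "E powr (1 / r)"]) auto
qed

lemma coefficient_cancel:
  assumes "n \<ge> 1" "0 \<le> C"
  shows "ennreal (real n powr (1 / u)) * ennreal (C * real n powr (-(1 / u))) = ennreal C"
proof -
  have "real n powr (1 / u) * (C * real n powr (-(1 / u))) = C * (real n powr (1 / u) * real n powr (-(1 / u)))"
    by simp
  also have "\<dots> = C" using assms(1) by (simp add: powr_add[symmetric])
  finally show ?thesis using assms(2) by (simp add: ennreal_mult[symmetric])
qed

lemma lower_quantization_coefficient_ge:
  assumes "\<forall>\<^sub>F n in sequentially. ennreal (C * real n powr (-(1 / u))) \<le> quantization_error n r P" "0 \<le> C"
  shows "ennreal C \<le> lower_quantization_coefficient u r P"
  unfolding lower_quantization_coefficient_def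
proof (rule Liminf_bounded)
  show "\<forall>\<^sub>F n in sequentially. ennreal C \<le> ennreal (real n powr (1 / u)) * quantization_error n r P"
    using assms(1) eventually_ge_at_top[of 1]
  proof eventually_elim
    case (elim n)
    show ?case unfolding coefficient_cancel[OF elim(2) assms(2), of u, symmetric]
      using elim(1) by (intro mult_left_mono) auto
  qed
qed

lemma upper_quantization_coefficient_le:
  assumes "\<forall>\<^sub>F n in sequentially. quantization_error n r P \<le> ennreal (C * real n powr (-(1 / u)))" "0 \<le> C"
  shows "upper_quantization_coefficient u r P \<le> ennreal C"
  unfolding upper_quantization_coefficient_def
proof (rule Limsup_bounded)
  show "\<forall>\<^sub>F n in sequentially. ennreal (real n powr (1 / u)) * quantization_error n r P \<le> ennreal C"
    using assms(1) eventually_ge_at_top[of 1]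
  proof eventually_elim
    case (elim n)
    show ?case unfolding coefficient_cancel[OF elim(2) assms(2), of u, symmetric]
      using elim(1) by (intro mult_left_mono) auto
  qed
qed

text \<open>The quotient is squeezed between those of the two explicit rates, in which the constants
  disappear in the limit. The lower rate at \<open>s\<close> settles the liminf; for the limsup
  \<open>u\<close> tends to \<open>s\<close> from above, so the upper side need not be sharp at
  \<open>s\<close>.\<close>

lemma has_quantization_dimensionI:
  assumes s: "s > 0" and C: "C > 0"
    "\<forall>\<^sub>F n in sequentially. ennreal (C * real n powr (-(1 / s))) \<le> quantization_error n r P"
    and up: "\<And>u. u > s \<Longrightarrow>
      \<exists>D>0. \<forall>\<^sub>F n in sequentially. quantization_error n r P \<le> ennreal (D * real n powr (-(1 / u)))"
  shows "has_quantization_dimension r P (ereal s)"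
proof -
  define X where "X n = ereal (ln (real n)) / (- ennreal_ln (quantization_error n r P))" for n
  have lim: "(\<lambda>n. ereal (ln (real n) / (ln (real n) / u - c))) \<longlonglongrightarrow> ereal u" if "u > 0" for u c
  proof -
    have "(\<lambda>n. ln (real n) / (ln (real n) / u - c)) \<longlonglongrightarrow> u" using that by real_asymp
    then show ?thesis by simp
  qed
  have bounds: "\<forall>\<^sub>F n in sequentially. ereal (ln (real n) / (ln (real n) / s - ln C)) \<le> X n \<and>
      X n \<le> ereal (ln (real n) / (ln (real n) / u - ln D))"
    if u: "u > s" and D: "D > 0"
      "\<forall>\<^sub>F n in sequentially. quantization_error n r P \<le> ennreal (D * real n powr (-(1 / u)))" for u D
  proof -
    have "\<forall>\<^sub>F n in sequentially. ln (real n) / u - ln D > 0" using u s by real_asymp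
    with C(2) D(2) eventually_gt_at_top[of 1] show ?thesis
    proof eventually_elim
      case (elim n)
      have e: "quantization_error n r P < top" using elim(2) by (rule le_less_trans) simp
      define x where "x = enn2real (quantization_error n r P)"
      have x: "quantization_error n r P = ennreal x" "x \<ge> 0" using e by (simp_all add: x_def)
      have lo: "C * real n powr (-(1 / s)) \<le> x" using elim(1) x by simp
      have hi: "x \<le> D * real n powr (-(1 / u))" using elim(2) x D(1) by (simp add: ennreal_le_iff)
      have "0 < C * real n powr (-(1 / s))" using C(1) elim(3) by simp
      with lo have xp: "x > 0" by linarith
      have "ln (C * real n powr (-(1 / s))) \<le> ln x" using lo C(1) elim(3) xp by (subst ln_le_cancel_iff) auto
      then have l1: "- ln x \<le> ln (real n) / s - ln C" using C(1) elim(3) by (simp add: ln_mult ln_powr)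
      have "ln x \<le> ln (D * real n powr (-(1 / u)))" using hi D(1) elim(3) xp by (subst ln_le_cancel_iff) auto
      then have l2: "ln (real n) / u - ln D \<le> - ln x" using D(1) elim(3) by (simp add: ln_mult ln_powr)
      \<comment> \<open>An error equal to 1 would mean division by zero, which \<open>ereal\<close>
        and \<open>real\<close> evaluate differently.\<close>
      have "x \<noteq> 1" using l2 elim(4) by auto
      then have "X n = ereal (ln (real n) / (- ln x))"
        using x xp by (simp add: X_def ennreal_ln_def)
      moreover have n0: "ln (real n) \<ge> 0" using elim(3) by simp
      have "ln (real n) / (ln (real n) / s - ln C) \<le> ln (real n) / (- ln x)"
        using l1 l2 elim(4) n0 by (intro divide_left_mono mult_pos_pos; linarith)
      moreover have "ln (real n) / (- ln x) \<le> ln (real n) / (ln (real n) / u - ln D)"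
        using l2 elim(4) n0 by (intro divide_left_mono mult_pos_pos; linarith)
      ultimately show ?case by (simp only: ereal_less_eq)
    qed
  qed
  \<comment> \<open>Any \<open>u > s\<close> would do. Even the lower bound of the quotient needs
    some upper rate, to make the error eventually less than 1 and the denominator positive.\<close>
  obtain D where D: "D > 0" "\<forall>\<^sub>F n in sequentially. quantization_error n r P \<le> ennreal (D * real n powr (-(1 / (s + 1))))"
    using up[of "s + 1"] by auto
  have "\<forall>\<^sub>F n in sequentially. ereal (ln (real n) / (ln (real n) / s - ln C)) \<le> X n"
    using bounds[OF _ D] by (auto elim: eventually_mono)
  then have "liminf (\<lambda>n. ereal (ln (real n) / (ln (real n) / s - ln C))) \<le> liminf X" by (rule Liminf_mono)
  then have lo: "ereal s \<le> liminf X" using lim_imp_Liminf[OF _ lim[OF s]] by simp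
  have hi: "limsup X \<le> ereal u" if u: "u > s" for u
  proof -
    obtain D where D: "D > 0" "\<forall>\<^sub>F n in sequentially. quantization_error n r P \<le> ennreal (D * real n powr (-(1 / u)))"
      using up[OF u] by blast
    have "\<forall>\<^sub>F n in sequentially. X n \<le> ereal (ln (real n) / (ln (real n) / u - ln D))"
      using bounds[OF u D] by (auto elim: eventually_mono)
    then have "limsup X \<le> limsup (\<lambda>n. ereal (ln (real n) / (ln (real n) / u - ln D)))" by (rule Limsup_mono)
    then show ?thesis using lim_imp_Limsup[OF _ lim[of u]] u s by simp
  qed
  have "limsup X \<le> ereal s"
  proof (rule ereal_le_epsilon2)
    fix e :: real assume "e > 0"
    then show "limsup X \<le> ereal s + ereal e" using hi[of "s + e"] by simp
  qed
  moreover have "liminf X \<le> limsup X" by (rule Liminf_le_Limsup) simp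
  ultimately show ?thesis using lo
    unfolding has_quantization_dimension_def lower_quantization_dimension_def upper_quantization_dimension_def
      X_def[symmetric] by (auto intro: antisym order_trans)
qed

section \<open>Inhomogeneous self-similar measures\<close>

context similitude_system
begin

text \<open>The bases lie strictly between 0 and 1 and the exponent grows with \<open>u\<close>, so
  beyond the root of its equation the sum drops below 1.\<close>

lemma weight_sum_less:
  assumes q: "\<And>i. i \<in> {1..N} \<Longrightarrow> 0 < q i \<and> q i \<le> 1" and N: "N \<ge> 1" and r: "r > 0" and uv: "0 < v" "v < u"
  shows "(\<Sum>i=1..N. (q i * s i powr r) powr (1 / (1 + r / u))) < (\<Sum>i=1..N. (q i * s i powr r) powr (1 / (1 + r / v)))"
proof (rule sum_strict_mono)
  fix i assume i: "i \<in> {1..N}"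
  have "q i * s i powr r < 1" using weight_powr(4)[OF i, of "q i" r 1] q[OF i] r by simp
  moreover have "0 < q i * s i powr r" using q[OF i] s_pos[OF i] by simp
  moreover have "1 / (1 + r / v) < 1 / (1 + r / u)" using uv r by (simp add: field_simps)
  ultimately show "(q i * s i powr r) powr (1 / (1 + r / u)) < (q i * s i powr r) powr (1 / (1 + r / v))"
    by (intro powr_less_mono') auto
qed (use N in auto)

text \<open>The threshold \<open>m\<close> is a parameter because the argument with levels needs one
  value below the shares of \<open>t\<close> and of \<open>p\<close> alike.\<close>

lemma cut_bound_of_weights:
  assumes P: "superinvariant q P" and q: "\<And>i. i \<in> {1..N} \<Longrightarrow> 0 < q i \<and> q i \<le> 1"
    and N: "N \<ge> 1" and r: "r > 0" "\<rho> > 0"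
    and sum: "(\<Sum>i=1..N. (q i * s i powr r) powr (1 / (1 + \<rho>))) = 1"
    and m: "0 < m" "\<And>i. i \<in> {1..N} \<Longrightarrow> m \<le> (q i * s i powr r) powr (1 / (1 + \<rho>))" and x: "m \<le> x"
  shows "cut_bound P r (m powr (1 + \<rho>)) (1 + \<rho>) x (nn_integral P)"
proof -
  define b where "b i = (q i * s i powr r) powr (1 / (1 + \<rho>))" for i
  have b: "0 < b i" "b i < 1" "b i powr (1 + \<rho>) = q i * s i powr r" if "i \<in> {1..N}" for i
    using weight_powr[OF that _ _ r, of "q i"] q[OF that] by (auto simp: b_def)
  obtain m' \<beta> where \<beta>: "0 < m'" "m' \<le> \<beta>" "\<beta> < 1" "\<And>i. i \<in> {1..N} \<Longrightarrow> b i \<le> \<beta>"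
    using finite_bounds[OF N, of b] b(1,2) by metis
  show ?thesis
  proof (rule cut_bound_superinvariant[OF P, where b=b and \<beta>=\<beta>])
    show "1 \<le> (\<Sum>i=1..N. b i)" using sum by (simp add: b_def)
    show "\<And>i. i \<in> {1..N} \<Longrightarrow> m \<le> b i" using m(2) by (simp add: b_def)
    show "0 < \<beta>" using \<beta>(1,2) by simp
    show "0 \<le> 1 + \<rho>" using r by simp
    show "\<And>i. i \<in> {1..N} \<Longrightarrow> 0 \<le> q i" using q by (simp add: less_imp_le)
  qed (fact b(3) \<beta>(3,4) m(1) x)+
qed

end

locale inhomogeneous_system = similitude_system N f s
  for N :: nat and f :: "nat \<Rightarrow> 'a::euclidean_space \<Rightarrow> 'a" and s :: "nat \<Rightarrow> real" +
  fixes t p :: "nat \<Rightarrow> real" and \<nu> \<mu> :: "'a measure"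
  assumes N: "N \<ge> 1"
    and osc: "open_set_condition N f"
    and t: "positive_probability_vector {1..N} t"
    and \<nu>: "self_similar_measure N f t \<nu>"
    and p: "positive_probability_vector {0..N} p"
    and \<mu>: "inhomogeneous_self_similar_measure N f p \<nu> \<mu>"
begin

lemma t_bounds: "i \<in> {1..N} \<Longrightarrow> 0 < t i \<and> t i \<le> 1"
  using t member_le_sum[of i "{1..N}" t] by (auto simp: positive_probability_vector_def less_imp_le)

lemma p_bounds: "i \<in> {0..N} \<Longrightarrow> 0 < p i \<and> p i \<le> 1"
  using p member_le_sum[of i "{0..N}" p] by (auto simp: positive_probability_vector_def less_imp_le)

lemma measures: "prob_space \<nu>" "sets \<nu> = sets borel" "prob_space \<mu>" "sets \<mu> = sets borel"
  using \<nu> \<mu> by (auto simp: self_similar_measure_def inhomogeneous_self_similar_measure_def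
    borel_probability_measure_def)

lemma superinvariant_\<nu>: "superinvariant t \<nu>"
  unfolding superinvariant_def using self_similar_nn_integral[OF \<nu>] by simp

lemma superinvariant_\<mu>: "superinvariant p \<mu>"
  unfolding superinvariant_def using inhomogeneous_nn_integral[OF \<mu> measures(2)] by simp

lemma bounded_support:
  obtains R0 where "R0 > 0" "\<And>R i. R0 \<le> R \<Longrightarrow> i \<in> {1..N} \<Longrightarrow> norm (f i 0) + s i * R \<le> R"
    "\<And>R. R0 \<le> R \<Longrightarrow> emeasure \<nu> {x. norm x > R} = 0"
    "\<And>R. R0 \<le> R \<Longrightarrow> emeasure \<mu> {x. norm x > R} = 0"
proof -
  obtain R0 where R0: "R0 > 0" "\<And>R i. R0 \<le> R \<Longrightarrow> i \<in> {1..N} \<Longrightarrow> norm (f i 0) + s i * R \<le> R"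
    using invariant_cball by metis
  have 1: "emeasure \<nu> {x. norm x > R} = 0" if "R0 + 1 \<le> R" for R
    by (rule self_similar_support[OF \<nu> t N R0(2)[OF order_refl]]) (use that in simp_all)
  have 2: "emeasure \<mu> {x. norm x > R} = 0" if "R0 + 1 \<le> R" for R
    by (rule inhomogeneous_support[OF \<mu> p R0(2) 1[OF that]]) (use that in simp_all)
  show ?thesis using R0 1 2 by (intro that[of "R0 + 1"]) auto
qed

text \<open>The asymmetry is deliberate: equality for \<open>t\<close> admits
  \<open>u = \<xi>1\<close> in case (a), while the recursion for \<open>\<mu>\<close> needs strict
  inequality for \<open>p\<close>.\<close>

lemma quantizable_\<mu>:
  assumes r: "r > 0" and u: "u > 0"
    and t1: "(\<Sum>i=1..N. (t i * s i powr r) powr (1 / (1 + r / u))) \<le> 1"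
    and p1: "(\<Sum>i=1..N. (p i * s i powr r) powr (1 / (1 + r / u))) < 1"
  shows "\<exists>D>0. \<forall>\<^sub>F n in sequentially. quantization_error n r \<mu> \<le> ennreal (D * real n powr (-(1 / u)))"
proof -
  obtain R where R: "R > 0" "emeasure \<nu> {x. norm x > R} = 0" "emeasure \<mu> {x. norm x > R} = 0"
    using bounded_support by (metis order_refl)
  have ru: "r / u > 0" using r u by simp
  obtain K0 where "K0 \<ge> 0" "quantizable \<nu> r (r / u) K0"
    using quantizable_self_similar[OF \<nu> t_bounds N R(2) less_imp_le[OF R(1)] r ru t1] by blast
  then obtain K where "K \<ge> 0" "quantizable \<mu> r (r / u) K"
    using quantizable_inhomogeneous[OF \<mu> measures(2) p_bounds N R(3) less_imp_le[OF R(1)] r ru p1] by blast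
  then show ?thesis using quantizable_upper_rate r u by blast
qed

text \<open>Serves the case \<open>\<xi>1 < \<xi>2\<close>: the antichain argument is applied to
  \<open>\<mu>\<close> directly, as it dominates its own images with the weights
  \<open>p\<close>.\<close>

lemma lower_rate_p:
  assumes r: "r > 0" and u: "u > 0"
    and p1: "(\<Sum>i=1..N. (p i * s i powr r) powr (1 / (1 + r / u))) = 1"
  shows "\<exists>C>0. \<forall>\<^sub>F n in sequentially. ennreal (C * real n powr (-(1 / u))) \<le> quantization_error n r \<mu>"
proof -
  have ru: "r / u > 0" using r u by simp
  define b where "b i = (p i * s i powr r) powr (1 / (1 + r / u))" for i
  have pb: "0 < p i \<and> p i \<le> 1" if "i \<in> {1..N}" for i using p_bounds that by simp
  have b: "0 < b i" "b i < 1" if "i \<in> {1..N}" for i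
    using weight_powr[OF that _ _ r ru, of "p i"] pb[OF that] by (auto simp: b_def)
  obtain m \<beta> where m: "0 < m" "m \<le> \<beta>" "\<beta> < 1" "\<And>i. i \<in> {1..N} \<Longrightarrow> m \<le> b i"
    using finite_bounds[OF N, of b] b by metis
  obtain R0 where R0: "\<And>R i. R0 \<le> R \<Longrightarrow> i \<in> {1..N} \<Longrightarrow> norm (f i 0) + s i * R \<le> R"
    "\<And>R. R0 \<le> R \<Longrightarrow> emeasure \<mu> {x. norm x > R} = 0"
    using bounded_support by metis
  have "m powr (1 + r / u) > 0" using m by simp
  then have "\<exists>\<kappa>>0. \<forall>n\<ge>1. \<forall>\<Phi>. cut_bound \<mu> r (m powr (1 + r / u)) (1 + r / u) (2 * real n) \<Phi> \<longrightarrow>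
    (\<forall>\<alpha>. finite \<alpha> \<longrightarrow> \<alpha> \<noteq> {} \<longrightarrow> card \<alpha> \<le> n \<longrightarrow>
      ennreal (\<kappa> * real n powr (-(r / u))) \<le> \<Phi> (\<lambda>x. ennreal (infdist x \<alpha> powr r)))"
    using pb by (intro cut_bound_error[OF N osc R0(1) measures(3,4) superinvariant_\<mu> _ R0(2) _ r]) blast+
  then obtain \<kappa> where \<kappa>: "\<kappa> > 0"
    and e: "\<forall>n\<ge>1. \<forall>\<Phi>. cut_bound \<mu> r (m powr (1 + r / u)) (1 + r / u) (2 * real n) \<Phi> \<longrightarrow>
    (\<forall>\<alpha>. finite \<alpha> \<longrightarrow> \<alpha> \<noteq> {} \<longrightarrow> card \<alpha> \<le> n \<longrightarrow>
      ennreal (\<kappa> * real n powr (-(r / u))) \<le> \<Phi> (\<lambda>x. ennreal (infdist x \<alpha> powr r)))"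
    by blast
  note e = e[rule_format]
  have "ennreal (\<kappa> powr (1 / r) * real n powr (-(1 / u))) \<le> quantization_error n r \<mu>" if n: "n \<ge> 1" for n
  proof (rule quantization_error_lower_rate[OF _ less_imp_le[OF \<kappa>] r u n])
    have "cut_bound \<mu> r (m powr (1 + r / u)) (1 + r / u) (2 * real n) (nn_integral \<mu>)"
      using m n by (intro cut_bound_of_weights[OF superinvariant_\<mu> pb N r ru p1]) (auto simp: b_def)
    then show "finite \<alpha> \<Longrightarrow> \<alpha> \<noteq> {} \<Longrightarrow> card \<alpha> \<le> n \<Longrightarrow> ennreal (\<kappa> * real n powr (-(r / u)))
      \<le> (\<integral>\<^sup>+x. ennreal (infdist x \<alpha> powr r) \<partial>\<mu>)" for \<alpha>
      using e[OF n] by blast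
  qed
  then show ?thesis using \<kappa> by (intro exI[of _ "\<kappa> powr (1 / r)"]) (auto intro: eventually_sequentiallyI)
qed

text \<open>Level 0 alone yields the rate for every \<open>n \<ge> 1\<close>. If \<open>u\<close>
  solves the equation for \<open>p\<close> as well, each of the first \<open>L\<close> levels
  contributes the same amount once \<open>n\<close> is large in terms of \<open>L\<close>, while
  \<open>\<kappa>\<close> stays fixed.\<close>

lemma level_lower_rate:
  assumes r: "r > 0" and u: "u > 0"
    and t1: "(\<Sum>i=1..N. (t i * s i powr r) powr (1 / (1 + r / u))) = 1"
  obtains \<kappa> where "\<kappa> > 0"
    "\<And>n. n \<ge> 1 \<Longrightarrow> ennreal (\<kappa> powr (1 / r) * real n powr (-(1 / u))) \<le> quantization_error n r \<mu>"
    "\<And>L. (\<Sum>i=1..N. (p i * s i powr r) powr (1 / (1 + r / u))) = 1 \<Longrightarrow> \<forall>\<^sub>F n in sequentially.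
      ennreal ((real L * \<kappa>) powr (1 / r) * real n powr (-(1 / u))) \<le> quantization_error n r \<mu>"
proof -
  have ru: "r / u > 0" using r u by simp
  define a where "a i = (t i * s i powr r) powr (1 / (1 + r / u))" for i
  define b where "b i = (p i * s i powr r) powr (1 / (1 + r / u))" for i
  have pb: "0 < p i \<and> p i \<le> 1" if "i \<in> {1..N}" for i using p_bounds that by simp
  have a: "0 < a i" "a i < 1" if "i \<in> {1..N}" for i
    using weight_powr[OF that _ _ r ru, of "t i"] t_bounds[OF that] by (auto simp: a_def)
  have b: "0 < b i" "b i < 1" "b i powr (1 + r / u) = p i * s i powr r" if "i \<in> {1..N}" for i
    using weight_powr[OF that _ _ r ru, of "p i"] pb[OF that] by (auto simp: b_def)
  obtain ma \<beta>a where ma: "0 < ma" "ma \<le> \<beta>a" "\<beta>a < 1" "\<And>i. i \<in> {1..N} \<Longrightarrow> ma \<le> a i"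
    using finite_bounds[OF N, of a] a by metis
  obtain mb \<beta>b where mb: "0 < mb" "mb \<le> \<beta>b" "\<beta>b < 1" "\<And>i. i \<in> {1..N} \<Longrightarrow> mb \<le> b i"
    using finite_bounds[OF N, of b] b by metis
  define m where "m = min ma mb"
  have m: "0 < m" "m < 1" "\<And>i. i \<in> {1..N} \<Longrightarrow> m \<le> a i" "\<And>i. i \<in> {1..N} \<Longrightarrow> m \<le> b i"
    using ma mb by (auto simp: m_def min_le_iff_disj min_less_iff_disj)
  obtain R0 where R0: "\<And>R i. R0 \<le> R \<Longrightarrow> i \<in> {1..N} \<Longrightarrow> norm (f i 0) + s i * R \<le> R"
    "\<And>R. R0 \<le> R \<Longrightarrow> emeasure \<nu> {x. norm x > R} = 0"
    using bounded_support by metis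
  have "m powr (1 + r / u) > 0" using m by simp
  then have "\<exists>\<kappa>>0. \<forall>n\<ge>1. \<forall>\<Phi>. cut_bound \<nu> r (m powr (1 + r / u)) (1 + r / u) (2 * real n) \<Phi> \<longrightarrow>
    (\<forall>\<alpha>. finite \<alpha> \<longrightarrow> \<alpha> \<noteq> {} \<longrightarrow> card \<alpha> \<le> n \<longrightarrow>
      ennreal (\<kappa> * real n powr (-(r / u))) \<le> \<Phi> (\<lambda>x. ennreal (infdist x \<alpha> powr r)))"
    using t_bounds by (intro cut_bound_error[OF N osc R0(1) measures(1,2) superinvariant_\<nu> _ R0(2) _ r]) blast+
  then obtain \<kappa> where \<kappa>: "\<kappa> > 0"
    and e: "\<forall>n\<ge>1. \<forall>\<Phi>. cut_bound \<nu> r (m powr (1 + r / u)) (1 + r / u) (2 * real n) \<Phi> \<longrightarrow>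
    (\<forall>\<alpha>. finite \<alpha> \<longrightarrow> \<alpha> \<noteq> {} \<longrightarrow> card \<alpha> \<le> n \<longrightarrow>
      ennreal (\<kappa> * real n powr (-(r / u))) \<le> \<Phi> (\<lambda>x. ennreal (infdist x \<alpha> powr r)))"
    by blast
  note e = e[rule_format]
  have p0: "p 0 > 0" using p_bounds[of 0] by simp
  have cut: "cut_bound \<nu> r (m powr (1 + r / u)) (1 + r / u) x (nn_integral \<nu>)" if "m \<le> x" for x
    using m that by (intro cut_bound_of_weights[OF superinvariant_\<nu> t_bounds N r ru t1]) (auto simp: a_def)
  have sum_level: "ennreal (real L * (p 0 * \<kappa>) * real n powr (-(r / u))) \<le> (\<integral>\<^sup>+x. ennreal (infdist x \<alpha> powr r) \<partial>\<mu>)"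
    if h: "\<And>k. k < L \<Longrightarrow> cut_bound \<nu> r (m powr (1 + r / u)) (1 + r / u) (2 * real n) (level p \<nu> k)"
      "n \<ge> 1" "finite \<alpha>" "\<alpha> \<noteq> {}" "card \<alpha> \<le> n" for L n \<alpha>
  proof -
    have "ennreal (real L * (p 0 * \<kappa>) * real n powr (-(r / u)))
      = (\<Sum>k<L. ennreal (p 0) * ennreal (\<kappa> * real n powr (-(r / u))))"
      using p0 \<kappa> by (simp add: ennreal_mult[symmetric] ennreal_of_nat_eq_real_of_nat mult_ac)
    also have "\<dots> \<le> (\<Sum>k<L. ennreal (p 0) * level p \<nu> k (\<lambda>x. ennreal (infdist x \<alpha> powr r)))"
      using e[OF h(2) h(1) h(3-5)] by (intro sum_mono mult_left_mono) auto
    also have "\<dots> \<le> (\<integral>\<^sup>+x. ennreal (infdist x \<alpha> powr r) \<partial>\<mu>)"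
      by (rule level_sum_le[OF \<mu> measures(2) infdist_powr_measurable])
    finally show ?thesis .
  qed
  have p\<kappa>: "p 0 * \<kappa> > 0" using p0 \<kappa> by simp
  have rate1: "ennreal ((p 0 * \<kappa>) powr (1 / r) * real n powr (-(1 / u))) \<le> quantization_error n r \<mu>"
    if n: "n \<ge> 1" for n
  proof (rule quantization_error_lower_rate[OF _ less_imp_le[OF p\<kappa>] r u n])
    have "level p \<nu> 0 = nn_integral \<nu>" by (rule ext) simp
    then have "cut_bound \<nu> r (m powr (1 + r / u)) (1 + r / u) (2 * real n) (level p \<nu> k)" if "k < 1" for k
      using that cut[of "2 * real n"] m n by simp
    then show "finite \<alpha> \<Longrightarrow> \<alpha> \<noteq> {} \<Longrightarrow> card \<alpha> \<le> n \<Longrightarrow> ennreal (p 0 * \<kappa> * real n powr (-(r / u)))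
      \<le> (\<integral>\<^sup>+x. ennreal (infdist x \<alpha> powr r) \<partial>\<mu>)" for \<alpha>
      using sum_level[of 1 n \<alpha>] n by simp
  qed
  have rate: "\<forall>\<^sub>F n in sequentially.
      ennreal ((real L * (p 0 * \<kappa>)) powr (1 / r) * real n powr (-(1 / u))) \<le> quantization_error n r \<mu>"
    if p1: "(\<Sum>i=1..N. (p i * s i powr r) powr (1 / (1 + r / u))) = 1" for L
  proof -
    \<comment> \<open>From this size on, \<open>2 * n * m ^ k\<close> is at least \<open>m\<close>
      for all \<open>k < L\<close>, so each of these levels has a cut into \<open>2 * n\<close>
      words.\<close>
    have "\<forall>\<^sub>F n in sequentially. 1 / m ^ L \<le> real n"
      using filterlim_real_sequentially unfolding filterlim_at_top by blast
    then show ?thesis using eventually_ge_at_top[of 1]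
    proof eventually_elim
      case (elim n)
      show ?case
      proof (rule quantization_error_lower_rate[OF _ _ r u elim(2)])
        show "0 \<le> real L * (p 0 * \<kappa>)" using p\<kappa> by simp
        have "cut_bound \<nu> r (m powr (1 + r / u)) (1 + r / u) (2 * real n) (level p \<nu> k)" if k: "k < L" for k
        proof (rule cut_bound_level[OF cut m(4) b(3) _ m(1)])
          show "1 \<le> (\<Sum>i=1..N. b i)" using p1 by (simp add: b_def)
          show "\<And>i. i \<in> {1..N} \<Longrightarrow> 0 \<le> p i" using pb by (simp add: less_imp_le)
          have "m ^ L \<le> m ^ k" using k m by (intro power_decreasing) auto
          then have "real n * m ^ L \<le> real n * m ^ k" by (intro mult_left_mono) auto
          moreover have "1 \<le> real n * m ^ L" using elim(1) m(1) by (simp add: field_simps)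
          ultimately show "m \<le> 2 * real n * m ^ k" using m(2) by linarith
        qed
        then show "finite \<alpha> \<Longrightarrow> \<alpha> \<noteq> {} \<Longrightarrow> card \<alpha> \<le> n \<Longrightarrow> ennreal (real L * (p 0 * \<kappa>) * real n powr (-(r / u)))
          \<le> (\<integral>\<^sup>+x. ennreal (infdist x \<alpha> powr r) \<partial>\<mu>)" for \<alpha>
          using sum_level[of L n \<alpha>] elim(2) by blast
      qed
    qed
  qed
  show ?thesis by (rule that[OF p\<kappa> rate1 rate])
qed

theorem inhomogeneous_quantization:
  assumes r: "r > 0" and \<xi>1: "\<xi>1 > 0" "(\<Sum>i=1..N. (t i * s i powr r) powr (\<xi>1 / (\<xi>1 + r))) = 1"
    and \<xi>2: "\<xi>2 > 0" "(\<Sum>i=1..N. (p i * s i powr r) powr (\<xi>2 / (\<xi>2 + r))) = 1"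
  defines "\<xi> \<equiv> max \<xi>1 \<xi>2"
  shows "has_quantization_dimension r \<mu> (ereal \<xi>)"
    and "lower_quantization_coefficient \<xi> r \<mu> > 0"
    and "\<xi>1 > \<xi>2 \<Longrightarrow> upper_quantization_coefficient \<xi> r \<mu> < \<infinity>"
    and "\<xi>1 = \<xi>2 \<Longrightarrow> lower_quantization_coefficient \<xi> r \<mu> = \<infinity>"
proof -
  have ex: "\<xi>' / (\<xi>' + r) = 1 / (1 + r / \<xi>')" if "\<xi>' > 0" for \<xi>' using that r by (simp add: field_simps)
  have t1: "(\<Sum>i=1..N. (t i * s i powr r) powr (1 / (1 + r / \<xi>1))) = 1" using \<xi>1 ex by simp
  have p1: "(\<Sum>i=1..N. (p i * s i powr r) powr (1 / (1 + r / \<xi>2))) = 1" using \<xi>2 ex by simp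
  have pb: "0 < p i \<and> p i \<le> 1" if "i \<in> {1..N}" for i using p_bounds that by simp
  have \<xi>: "\<xi> > 0" using \<xi>1(1) by (simp add: \<xi>_def)
  have upper: "\<exists>D>0. \<forall>\<^sub>F n in sequentially. quantization_error n r \<mu> \<le> ennreal (D * real n powr (-(1 / u)))"
    if u: "u \<ge> \<xi>1" "u > \<xi>2" for u
  proof (rule quantizable_\<mu>[OF r])
    show "u > 0" using u \<xi>1 by simp
    show "(\<Sum>i=1..N. (t i * s i powr r) powr (1 / (1 + r / u))) \<le> 1"
      using weight_sum_less[where q=t and v=\<xi>1 and u=u, OF t_bounds N r \<xi>1(1)] t1 u(1) by (cases "u = \<xi>1") auto
    show "(\<Sum>i=1..N. (p i * s i powr r) powr (1 / (1 + r / u))) < 1"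
      using weight_sum_less[where q=p, OF pb N r \<xi>2(1) u(2)] p1 by simp
  qed
  obtain \<kappa> where \<kappa>: "\<kappa> > 0"
    "\<And>n. n \<ge> 1 \<Longrightarrow> ennreal (\<kappa> powr (1 / r) * real n powr (-(1 / \<xi>1))) \<le> quantization_error n r \<mu>"
    "\<And>L. (\<Sum>i=1..N. (p i * s i powr r) powr (1 / (1 + r / \<xi>1))) = 1 \<Longrightarrow> \<forall>\<^sub>F n in sequentially.
      ennreal ((real L * \<kappa>) powr (1 / r) * real n powr (-(1 / \<xi>1))) \<le> quantization_error n r \<mu>"
    by (rule level_lower_rate[OF r \<xi>1(1) t1]) blast
  have lower: "\<exists>C>0. \<forall>\<^sub>F n in sequentially. ennreal (C * real n powr (-(1 / \<xi>))) \<le> quantization_error n r \<mu>"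
  proof (cases "\<xi>1 < \<xi>2")
    case True
    then show ?thesis using lower_rate_p[OF r \<xi>2(1) p1] by (simp add: \<xi>_def max_def)
  next
    case False
    then have "\<xi> = \<xi>1" by (simp add: \<xi>_def max_def)
    then show ?thesis using \<kappa>(1,2)
      by (intro exI[of _ "\<kappa> powr (1 / r)"]) (auto intro: eventually_sequentiallyI)
  qed
  then obtain C where C: "C > 0"
    "\<forall>\<^sub>F n in sequentially. ennreal (C * real n powr (-(1 / \<xi>))) \<le> quantization_error n r \<mu>" by blast
  show "has_quantization_dimension r \<mu> (ereal \<xi>)"
    by (rule has_quantization_dimensionI[OF \<xi> C]) (rule upper, auto simp: \<xi>_def)
  show "lower_quantization_coefficient \<xi> r \<mu> > 0"
    using lower_quantization_coefficient_ge[OF C(2)] C(1)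
    by (metis ennreal_less_zero_iff less_imp_le order_less_le_trans)
  show "upper_quantization_coefficient \<xi> r \<mu> < \<infinity>" if less: "\<xi>1 > \<xi>2"
  proof -
    obtain D where "D > 0" "\<forall>\<^sub>F n in sequentially. quantization_error n r \<mu> \<le> ennreal (D * real n powr (-(1 / \<xi>1)))"
      using upper[of \<xi>1] less by auto
    then have "upper_quantization_coefficient \<xi>1 r \<mu> \<le> ennreal D"
      by (intro upper_quantization_coefficient_le) auto
    then show ?thesis using less by (auto simp: \<xi>_def max_def intro: le_less_trans)
  qed
  show "lower_quantization_coefficient \<xi> r \<mu> = \<infinity>" if eq: "\<xi>1 = \<xi>2"
  proof -
    \<comment> \<open>With \<open>L\<close> levels the coefficient is at least
      \<open>(L * \<kappa>) powr (1 / r)\<close>; as \<open>\<kappa>\<close> does not depend on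
      \<open>L\<close>, the number of levels may be chosen after \<open>M\<close>.\<close>
    have "ennreal M \<le> lower_quantization_coefficient \<xi> r \<mu>" if M: "M > 0" for M
    proof -
      obtain L :: nat where "M powr r / \<kappa> \<le> real L" using real_arch_simple by blast
      then have "M powr r \<le> real L * \<kappa>" using \<kappa>(1) by (simp add: field_simps)
      then have "(M powr r) powr (1 / r) \<le> (real L * \<kappa>) powr (1 / r)" using r by (intro powr_mono2) auto
      then have "M \<le> (real L * \<kappa>) powr (1 / r)" using M r by (simp add: powr_powr)
      then have "ennreal M \<le> ennreal ((real L * \<kappa>) powr (1 / r))" by (rule ennreal_leI)
      also have "\<dots> \<le> lower_quantization_coefficient \<xi> r \<mu>"
        using \<kappa>(3)[of L] p1 eq by (intro lower_quantization_coefficient_ge) (auto simp: \<xi>_def)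
      finally show ?thesis .
    qed
    then have "of_nat n \<le> lower_quantization_coefficient \<xi> r \<mu>" for n
      by (cases n) (auto simp: ennreal_of_nat_eq_real_of_nat simp del: of_nat_Suc)
    then show ?thesis by (metis ennreal_Ex_less_of_nat infinity_ennreal_def leD less_top)
  qed
qed

end

theorem theorem1p2:
  fixes N :: nat
    and f :: "nat \<Rightarrow> real ^ 'q \<Rightarrow> real ^ 'q"
    and s t p :: "nat \<Rightarrow> real"
    and \<nu> \<mu> :: "(real ^ 'q) measure"
    and \<xi>1 \<xi>2 \<xi> :: "real \<Rightarrow> real"
  assumes "N \<ge> 2"
    and "\<And>i. i \<in> {1..N} \<Longrightarrow> contractive_similitude (f i) (s i)"
    and "open_set_condition N f"
    and "positive_probability_vector {1..N} t"
    and "self_similar_measure N f t \<nu>"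
    and "positive_probability_vector {0..N} p"
    and "inhomogeneous_self_similar_measure N f p \<nu> \<mu>"
    and "\<And>r. r > 0 \<Longrightarrow> \<xi>1 r > 0 \<and>
           (\<Sum>i=1..N. (t i * s i powr r) powr (\<xi>1 r / (\<xi>1 r + r))) = 1"
    and "\<And>r. r > 0 \<Longrightarrow> \<xi>2 r > 0 \<and>
           (\<Sum>i=1..N. (p i * s i powr r) powr (\<xi>2 r / (\<xi>2 r + r))) = 1"
    and "\<And>r. r > 0 \<Longrightarrow> \<xi> r = max (\<xi>1 r) (\<xi>2 r)"
  shows "\<forall>r>0.
      has_quantization_dimension r \<mu> (ereal (\<xi> r)) \<and>
      lower_quantization_coefficient (\<xi> r) r \<mu> > 0 \<and>
      (\<xi>1 r > \<xi>2 r \<longrightarrow> upper_quantization_coefficient (\<xi> r) r \<mu> < \<infinity>) \<and>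
      (\<xi>1 r = \<xi>2 r \<longrightarrow> lower_quantization_coefficient (\<xi> r) r \<mu> = \<infinity>)"
proof (intro allI impI)
  fix r :: real assume r: "r > 0"
  interpret inhomogeneous_system N f s t p \<nu> \<mu>
    using assms(1-7) by unfold_locales auto
  show "has_quantization_dimension r \<mu> (ereal (\<xi> r)) \<and>
      lower_quantization_coefficient (\<xi> r) r \<mu> > 0 \<and>
      (\<xi>1 r > \<xi>2 r \<longrightarrow> upper_quantization_coefficient (\<xi> r) r \<mu> < \<infinity>) \<and>
      (\<xi>1 r = \<xi>2 r \<longrightarrow> lower_quantization_coefficient (\<xi> r) r \<mu> = \<infinity>)"
    unfolding assms(10)[OF r]
    using inhomogeneous_quantization[OF r, of "\<xi>1 r" "\<xi>2 r"] assms(8,9)[OF r] by blast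
qed

end
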